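(* Let $g\in H^\infty(\mathbb{D})$ be such that $g(\mathbb{D})\cap\mathbb{D}=\varnothing$, $|g|>1$ almost everywhere on $\mathbb{T}$, and $\log(|g|-1)\in L^1(\mathbb{T})$. Then the operator $T_g^*$ on $H^2(\mathbb{D})$ is not $1$-weakly hypercyclic.
   Context: $\mathbb{D}$ is the open unit disk, $\mathbb{T}$ the unit circle with normalized Lebesgue measure; functions in $H^\infty(\mathbb{D})$ are identified with their boundary values on $\mathbb{T}$. $H^2(\mathbb{D})\subseteq L^2(\mathbb{T})$; for $g\in L^\infty(\mathbb{T})$, $T_g=PM_g$ where $M_g$ is multiplication by $g$ and $P$ is the orthogonal projection of $L^2(\mathbb{T})$ onto $H^2(\mathbb{D})$; $T_g^*$ is the Hilbert space adjoint. An operator $T$ on a complex Banach space $X$ is $1$-weakly hypercyclic if there is $x\in X$ such that for every non-zero continuous linear functional $f$ on $X$, the set $\{f(T^mx):m\in\mathbb{Z}_+\}$ is dense in $\mathbb{C}$. *)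

theory Defs
  imports "HOL-Analysis.Analysis"
begin

definition circle_measure :: "complex measure" where
  "circle_measure = distr (uniform_measure lborel {0..2*pi}) borel cis"

definition L2T :: "(complex \<Rightarrow> complex) set" where
  "L2T = {f. f \<in> borel_measurable circle_measure \<and>
              integrable circle_measure (\<lambda>z. (cmod (f z))^2)}"

definition l2_inner :: "(complex \<Rightarrow> complex) \<Rightarrow> (complex \<Rightarrow> complex) \<Rightarrow> complex" where
  "l2_inner f h = integral\<^sup>L circle_measure (\<lambda>z. f z * cnj (h z))"

definition l2_norm :: "(complex \<Rightarrow> complex) \<Rightarrow> real" where
  "l2_norm f = sqrt (integral\<^sup>L circle_measure (\<lambda>z. (cmod (f z))^2))"

definition fourier_coeff :: "(complex \<Rightarrow> complex) \<Rightarrow> int \<Rightarrow> complex" where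
  "fourier_coeff f k = integral\<^sup>L circle_measure (\<lambda>z. f z * cnj (z powi k))"

definition H2 :: "(complex \<Rightarrow> complex) set" where
  "H2 = {f \<in> L2T. \<forall>k::int. k < 0 \<longrightarrow> fourier_coeff f k = 0}"

definition boundary_value :: "(complex \<Rightarrow> complex) \<Rightarrow> complex \<Rightarrow> complex" where
  "boundary_value g z = Lim (at_left (1::real)) (\<lambda>r. g (complex_of_real r * z))"

definition Hinfty :: "(complex \<Rightarrow> complex) set" where
  "Hinfty = {g. g holomorphic_on ball 0 1 \<and> bounded (g ` ball 0 1)}"

definition cont_lin_functional_H2 :: "((complex \<Rightarrow> complex) \<Rightarrow> complex) \<Rightarrow> bool" where
  "cont_lin_functional_H2 \<phi> \<longleftrightarrow>
     (\<forall>f\<in>H2. \<forall>h\<in>H2. \<phi> (\<lambda>z. f z + h z) = \<phi> f + \<phi> h) \<and>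
     (\<forall>f\<in>H2. \<forall>c. \<phi> (\<lambda>z. c * f z) = c * \<phi> f) \<and>
     (\<forall>f\<in>H2. \<forall>e>0. \<exists>d>0. \<forall>h\<in>H2. l2_norm (\<lambda>z. h z - f z) < d \<longrightarrow> cmod (\<phi> h - \<phi> f) < e)"

definition one_weakly_hypercyclic_H2 :: "((complex \<Rightarrow> complex) \<Rightarrow> (complex \<Rightarrow> complex)) \<Rightarrow> bool" where
  "one_weakly_hypercyclic_H2 T \<longleftrightarrow>
     (\<exists>x\<in>H2. \<forall>\<phi>. cont_lin_functional_H2 \<phi> \<and> (\<exists>f\<in>H2. \<phi> f \<noteq> 0) \<longrightarrow>
        closure (range (\<lambda>m::nat. \<phi> ((T ^^ m) x))) = UNIV)"

end

theory Submission
  imports Defs "HOL-Complex_Analysis.Complex_Analysis" "HOL-Probability.Probability_Measure"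
begin

text \<open>
  Write \<open>G\<close> for the boundary function of \<open>g\<close>, which exists by Fatou's theorem. If \<open>x \<noteq> 0\<close>, pick \<open>j\<close> with
  \<open>\<langle>z\<^sup>j, x\<rangle> \<noteq> 0\<close>. Since \<open>1 / g\<close> is a bounded analytic function, \<open>f = exp (- Q) z\<^sup>j / G\<^sup>m\<close> lies in \<open>H\<^sup>2\<close> for every
  polynomial \<open>Q\<close>, and \<open>\<langle>f, A\<^sup>m x\<rangle> = \<langle>exp (- Q) z\<^sup>j, x\<rangle>\<close>. Integrability of \<open>log (\<bar>G\<bar> - 1)\<close> lets one choose \<open>Q\<close> with
  \<open>Re Q \<ge> 0\<close> on the circle and \<open>Q(0)\<close> small, so that \<open>exp (- Q)\<close> is close to \<open>1\<close> in \<open>H\<^sup>2\<close>, and with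
  \<open>Re Q\<close> so close to the part of \<open>- 2 log (min 1 (\<bar>G\<bar> - 1))\<close> above a fixed level that the norm of \<open>f\<close> is at most a
  constant times \<open>m\<^sup>-\<^sup>2\<close>. Hence the norm of \<open>A\<^sup>m x\<close> grows at least like \<open>m\<^sup>2\<close>, so that the reciprocals of these
  norms are summable, and Bang's lemma on plank coverings yields signs \<open>s\<^sub>m\<close> for which the functional
  \<open>\<Sum>m. s\<^sub>m \<parallel>A\<^sup>m x\<parallel>\<^sup>-\<^sup>2 \<langle>\<cdot>, A\<^sup>m x\<rangle>\<close> stays away from \<open>0\<close> along the orbit of \<open>x\<close>.
\<close>

section \<open>Normalised Lebesgue measure on the circle\<close>

lemma sets_circle_measure [measurable_cong, simp]: "sets circle_measure = sets borel"
  by (simp add: circle_measure_def)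

lemma space_circle_measure [simp]: "space circle_measure = UNIV"
  by (simp add: circle_measure_def)

lemma measurable_cis [measurable]: "cis \<in> borel_measurable borel"
  by (intro borel_measurable_continuous_onI continuous_intros)

lemma measurable_cnj [measurable]: "cnj \<in> borel_measurable borel"
  by (intro borel_measurable_continuous_onI continuous_intros)

interpretation circle: prob_space circle_measure
  unfolding circle_measure_def
  by (intro prob_space.prob_space_distr prob_space_uniform_measure) simp_all

interpretation circle_pair: pair_sigma_finite circle_measure circle_measure ..

lemma measure_circle_UNIV [simp]: "measure circle_measure UNIV = 1"
  using circle.prob_space by simp

lemma emeasure_circle_UNIV [simp]: "emeasure circle_measure UNIV = 1"
  using circle.emeasure_space_1 by simp

lemma AE_circle_norm: "AE z in circle_measure. cmod z = 1"
  unfolding circle_measure_def by (subst AE_distr_iff) auto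

lemma AE_circleI: "(\<And>z. cmod z = 1 \<Longrightarrow> P z) \<Longrightarrow> AE z in circle_measure. P z"
  using AE_circle_norm by (rule eventually_mono)

lemma integral_circle_cong:
  fixes f g :: "complex \<Rightarrow> 'a :: {banach, second_countable_topology}"
  assumes "f \<in> borel_measurable borel" "g \<in> borel_measurable borel"
    and "\<And>z. cmod z = 1 \<Longrightarrow> f z = g z"
  shows "integral\<^sup>L circle_measure f = integral\<^sup>L circle_measure g"
  using assms by (intro integral_cong_AE AE_circleI) auto

lemma bounded_on_circle:
  fixes f :: "complex \<Rightarrow> 'a :: real_normed_vector"
  assumes "continuous_on (sphere 0 1) f"
  obtains B where "\<And>z. cmod z = 1 \<Longrightarrow> norm (f z) \<le> B"
proof -
  have "bounded (f ` sphere 0 1)"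
    by (intro compact_imp_bounded compact_continuous_image assms compact_sphere)
  then obtain B where "\<forall>y\<in>f ` sphere 0 1. norm y \<le> B"
    unfolding bounded_iff by blast
  then show ?thesis
    by (intro that[of B]) auto
qed

lemma integrable_circle_bounded:
  fixes f :: "complex \<Rightarrow> 'a :: {banach, second_countable_topology}"
  assumes "f \<in> borel_measurable borel" and "\<And>z. cmod z = 1 \<Longrightarrow> norm (f z) \<le> B"
  shows "integrable circle_measure f"
  using assms by (intro circle.integrable_const_bound[where B = B] AE_circleI) auto

lemma integrable_circle_continuous:
  fixes f :: "complex \<Rightarrow> 'a :: {banach, second_countable_topology}"
  assumes "f \<in> borel_measurable borel" "continuous_on (sphere 0 1) f"
  shows "integrable circle_measure f"
  using assms bounded_on_circle integrable_circle_bounded by metis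

lemma integral_circle_continuous:
  fixes f :: "complex \<Rightarrow> complex"
  assumes [measurable]: "f \<in> borel_measurable borel" and cont: "continuous_on (sphere 0 1) f"
  shows "integral\<^sup>L circle_measure f = integral {0..2*pi} (\<lambda>t. f (cis t)) / (2 * pi)"
proof -
  have density: "uniform_measure lborel {0..2*pi} =
      density lborel (\<lambda>t. ennreal (indicator {0..2*pi} t / (2 * pi)))"
    unfolding uniform_measure_def
    by (rule density_cong) (auto split: split_indicator simp: divide_ennreal[symmetric])
  have "continuous_on {0..2*pi} (\<lambda>t. f (cis t))"
    by (rule continuous_on_compose2[OF cont]) (auto intro!: continuous_intros)
  then have set_integral: "(LINT t:{0..2*pi}|lborel. f (cis t)) = integral {0..2*pi} (\<lambda>t. f (cis t))"
    by (intro set_borel_integral_eq_integral borel_integrable_atLeastAtMost')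
  have "integral\<^sup>L circle_measure f = (\<integral>t. f (cis t) \<partial>uniform_measure lborel {0..2*pi})"
    unfolding circle_measure_def by (rule integral_distr) auto
  also have "\<dots> = (\<integral>t. (1 / (2 * pi)) *\<^sub>R (indicator {0..2*pi} t *\<^sub>R f (cis t)) \<partial>lborel)"
    unfolding density by (simp add: integral_density)
  also have "\<dots> = (1 / (2 * pi)) *\<^sub>R (LINT t:{0..2*pi}|lborel. f (cis t))"
    unfolding set_lebesgue_integral_def by (rule integral_scaleR_right)
  finally show ?thesis
    unfolding set_integral by (simp add: scaleR_conv_of_real field_simps)
qed

lemma one_minus_cnj_mult_nonzero:
  assumes "cmod a < 1" "cmod w \<le> 1"
  shows "1 - cnj a * w \<noteq> 0"
proof
  assume "1 - cnj a * w = 0"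
  then have "cmod (cnj a * w) = 1" by simp
  moreover have "cmod a * cmod w \<le> cmod a" using assms by (intro mult_left_le) auto
  ultimately show False using assms by (simp add: norm_mult)
qed

lemma Cauchy_integral_circle_measure:
  fixes h :: "complex \<Rightarrow> complex"
  assumes [measurable]: "h \<in> borel_measurable borel"
    and cont: "continuous_on (cball 0 1) h" and hol: "h holomorphic_on ball 0 1"
    and a: "cmod a < 1"
  shows "(\<integral>w. h w / (1 - a * cnj w) \<partial>circle_measure) = h a"
proof -
  have nonzero: "1 - a * cnj w \<noteq> 0" if "cmod w = 1" for w
    using one_minus_cnj_mult_nonzero[of "cnj a" "cnj w"] a that by simp
  have "((\<lambda>u. h u / (u - a)) has_contour_integral (2 * of_real pi * \<i> * h a)) (part_circlepath 0 1 0 (2*pi))"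
    using Cauchy_integral_circlepath[OF cont hol] a unfolding circlepath_def by simp
  then have "((\<lambda>t. h (cis t) / (cis t - a) * \<i> * cis t) has_integral (2 * of_real pi * \<i> * h a)) {0..2*pi}"
    by (subst (asm) has_contour_integral_part_circlepath_iff) (simp_all add: mult.assoc)
  from has_integral_mult_right[OF this, of "-\<i>"]
  have "((\<lambda>t. h (cis t) * (cis t / (cis t - a))) has_integral (2 * of_real pi * h a)) {0..2*pi}"
    by (simp add: algebra_simps)
  also have "(\<lambda>t. h (cis t) * (cis t / (cis t - a))) = (\<lambda>t. h (cis t) / (1 - a * cnj (cis t)))"
  proof
    fix t
    have "cis t - a = cis t * (1 - a * cnj (cis t))"
      by (simp add: right_diff_distrib mult.left_commute[of _ a] complex_norm_square[symmetric])
    then show "h (cis t) * (cis t / (cis t - a)) = h (cis t) / (1 - a * cnj (cis t))"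
      by simp
  qed
  finally have "integral {0..2*pi} (\<lambda>t. h (cis t) / (1 - a * cnj (cis t))) = 2 * of_real pi * h a"
    by (rule integral_unique)
  moreover have "continuous_on (sphere 0 1) (\<lambda>w. h w / (1 - a * cnj w))"
    by (intro continuous_intros continuous_on_subset[OF cont]) (use nonzero in auto)
  ultimately show ?thesis
    by (subst integral_circle_continuous) simp_all
qed

lemma mean_value_circle_measure:
  assumes "h \<in> borel_measurable borel" "continuous_on (cball 0 1) h" "h holomorphic_on ball 0 1"
  shows "integral\<^sup>L circle_measure h = h 0"
  using Cauchy_integral_circle_measure[OF assms, of 0] by simp

section \<open>The Poisson kernel\<close>

text \<open>For \<open>cmod w = 1\<close> this is the Poisson kernel of the disc. Its extension to the bidisc has the
  semigroup property that the maximal inequality needs.\<close>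

definition poisson_kernel :: "complex \<Rightarrow> complex \<Rightarrow> real" where
  "poisson_kernel a b = (1 - (cmod a * cmod b)\<^sup>2) / (cmod (1 - cnj b * a))\<^sup>2"

lemma measurable_poisson_kernel [measurable (raw)]:
  assumes [measurable]: "f \<in> borel_measurable M" "g \<in> borel_measurable M"
  shows "(\<lambda>x. poisson_kernel (f x) (g x)) \<in> borel_measurable M"
  unfolding poisson_kernel_def by measurable

lemma poisson_kernel_commute: "poisson_kernel a b = poisson_kernel b a"
proof -
  have "cmod (1 - cnj b * a) = cmod (cnj (1 - cnj b * a))"
    by (simp only: complex_mod_cnj)
  then show ?thesis
    by (simp add: poisson_kernel_def mult.commute)
qed

lemma poisson_kernel_nonneg: "cmod a \<le> 1 \<Longrightarrow> cmod b \<le> 1 \<Longrightarrow> 0 \<le> poisson_kernel a b"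
  unfolding poisson_kernel_def
  by (intro divide_nonneg_nonneg) (auto intro!: power_le_one mult_le_one)

lemma continuous_on_poisson_kernel:
  assumes "cmod a < 1"
  shows "continuous_on (sphere 0 1) (poisson_kernel a)"
proof -
  have "1 - cnj w * a \<noteq> 0" if "cmod w = 1" for w
    using one_minus_cnj_mult_nonzero[of "cnj a" "cnj w"] assms that by (simp add: mult.commute)
  then show ?thesis
    unfolding poisson_kernel_def by (intro continuous_intros) auto
qed

lemma poisson_kernel_le:
  assumes "cmod a \<le> R" "R < 1" "cmod w = 1"
  shows "poisson_kernel a w \<le> 1 / (1 - R)\<^sup>2"
proof -
  have "1 - R \<le> cmod (1 - cnj w * a)"
    using norm_triangle_ineq2[of 1 "cnj w * a"] assms by (simp add: norm_mult)
  then show ?thesis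
    unfolding poisson_kernel_def using assms by (intro frac_le power_mono) auto
qed

lemma Re_cayley: "Re ((1 + u) / (1 - u)) = (1 - (cmod u)\<^sup>2) / (cmod (1 - u))\<^sup>2"
  unfolding cmod_power2 Re_divide by (simp add: power2_eq_square algebra_simps)

lemma poisson_integral:
  fixes h :: "complex \<Rightarrow> complex"
  assumes [measurable]: "h \<in> borel_measurable borel"
    and cont: "continuous_on (cball 0 1) h" and hol: "h holomorphic_on ball 0 1"
    and a: "cmod a < 1"
  shows "(\<integral>w. complex_of_real (poisson_kernel a w) * h w \<partial>circle_measure) = h a"
proof -
  define k where "k = (\<lambda>w. h w * (1 - (cmod a)\<^sup>2) / (1 - cnj a * w))"
  have [measurable]: "k \<in> borel_measurable borel" unfolding k_def by measurable
  have "(\<integral>w. complex_of_real (poisson_kernel a w) * h w \<partial>circle_measure)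
      = (\<integral>w. k w / (1 - a * cnj w) \<partial>circle_measure)"
  proof (rule integral_circle_cong)
    fix w :: complex assume w: "cmod w = 1"
    have "(1 - cnj a * w) * (1 - a * cnj w) = (1 - cnj w * a) * cnj (1 - cnj w * a)"
      by (simp add: mult.commute)
    also have "\<dots> = complex_of_real ((cmod (1 - cnj w * a))\<^sup>2)"
      by (simp only: complex_norm_square)
    finally show "complex_of_real (poisson_kernel a w) * h w = k w / (1 - a * cnj w)"
      unfolding k_def poisson_kernel_def using w by (simp add: divide_divide_eq_left)
  qed measurable
  also have "\<dots> = k a"
  proof (rule Cauchy_integral_circle_measure)
    show "continuous_on (cball 0 1) k" unfolding k_def
      by (intro continuous_intros cont) (use one_minus_cnj_mult_nonzero[OF a] in auto)
    show "k holomorphic_on ball 0 1" unfolding k_def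
      by (intro holomorphic_intros hol) (use one_minus_cnj_mult_nonzero[OF a] in auto)
  qed (use a in auto)
  also have "\<dots> = h a"
  proof -
    have "complex_of_real ((cmod a)\<^sup>2) = cnj a * a"
      by (simp only: complex_norm_square mult.commute)
    then show ?thesis
      using one_minus_cnj_mult_nonzero[OF a, of a] a by (simp add: k_def)
  qed
  finally show ?thesis .
qed

lemma poisson_kernel_semigroup:
  assumes a: "cmod a < 1" and b: "cmod b < 1"
  shows "(\<integral>w. poisson_kernel a w * poisson_kernel b w \<partial>circle_measure) = poisson_kernel a b"
proof -
  define h where "h = (\<lambda>w. (1 + cnj b * w) / (1 - cnj b * w))"
  have [measurable]: "h \<in> borel_measurable borel" unfolding h_def by measurable
  have Re_h: "Re (h w) = poisson_kernel w b" for w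
    unfolding h_def Re_cayley poisson_kernel_def by (simp add: norm_mult mult.commute)
  have cont: "continuous_on (cball 0 1) h" unfolding h_def
    by (intro continuous_intros) (use one_minus_cnj_mult_nonzero[OF b] in auto)
  have hol: "h holomorphic_on ball 0 1" unfolding h_def
    by (intro holomorphic_intros) (use one_minus_cnj_mult_nonzero[OF b] in auto)
  have integrable: "integrable circle_measure (\<lambda>w. complex_of_real (poisson_kernel a w) * h w)"
    by (rule integrable_circle_continuous)
      (auto intro!: continuous_intros continuous_on_poisson_kernel a continuous_on_subset[OF cont])
  have "(\<integral>w. poisson_kernel a w * poisson_kernel b w \<partial>circle_measure)
      = (\<integral>w. Re (complex_of_real (poisson_kernel a w) * h w) \<partial>circle_measure)"
    by (simp add: Re_h poisson_kernel_commute[of b])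
  also have "\<dots> = Re (h a)"
    using poisson_integral[OF _ cont hol a] integral_Re[OF integrable] by simp
  finally show ?thesis by (simp add: Re_h)
qed

lemma nn_integral_poisson_kernel_semigroup:
  assumes a: "cmod a < 1" and b: "cmod b < 1"
  shows "(\<integral>\<^sup>+w. ennreal (poisson_kernel a w) * ennreal (poisson_kernel b w) \<partial>circle_measure) =
    ennreal (poisson_kernel a b)"
proof -
  have "(\<integral>\<^sup>+w. ennreal (poisson_kernel a w) * ennreal (poisson_kernel b w) \<partial>circle_measure) =
      (\<integral>\<^sup>+w. ennreal (poisson_kernel a w * poisson_kernel b w) \<partial>circle_measure)"
    using a b by (intro nn_integral_cong_AE AE_circleI) (simp add: ennreal_mult poisson_kernel_nonneg)
  also have "\<dots> = ennreal (\<integral>w. poisson_kernel a w * poisson_kernel b w \<partial>circle_measure)"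
  proof (rule nn_integral_eq_integral)
    show "integrable circle_measure (\<lambda>w. poisson_kernel a w * poisson_kernel b w)"
      by (rule integrable_circle_continuous)
        (auto intro!: continuous_intros continuous_on_poisson_kernel a b)
    show "AE w in circle_measure. 0 \<le> poisson_kernel a w * poisson_kernel b w"
      using a b by (intro AE_circleI) (simp add: poisson_kernel_nonneg)
  qed
  finally show ?thesis by (simp add: poisson_kernel_semigroup[OF a b])
qed

lemma poisson_kernel_le_smaller_radius:
  assumes z: "cmod z = 1" "cmod z' = 1" and r: "0 \<le> r" "r \<le> s" "s < 1"
  shows "poisson_kernel (of_real r * z) (of_real s * z') \<le> 8 * poisson_kernel (of_real r * z) z'"
proof -
  define u where "u = cnj z' * z"
  have u: "cmod u = 1" by (simp add: u_def norm_mult z)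
  have "cmod (1 - of_real r * u) \<le> cmod (1 - of_real (s * r) * u) + cmod (of_real (r * (1 - s)) * u)"
    by (rule order_trans[OF _ norm_triangle_ineq4]) (simp add: algebra_simps)
  also have "cmod (of_real (r * (1 - s)) * u) = r * (1 - s)"
    using r u by (simp add: norm_mult del: of_real_mult of_real_diff)
  also have "r * (1 - s) \<le> 1 - s * r" using r by (simp add: algebra_simps)
  also have "1 - s * r \<le> cmod (1 - of_real (s * r) * u)"
    using norm_triangle_ineq2[of 1 "of_real (s * r) * u"] r u by (simp add: norm_mult)
  finally have denominators: "cmod (1 - of_real r * u) \<le> 2 * cmod (1 - of_real (s * r) * u)" by simp
  have "0 < cmod (1 - of_real r * u)"
    using norm_triangle_ineq2[of 1 "of_real r * u"] r u
    by (auto simp: norm_mult simp del: zero_less_norm_iff)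
  have "poisson_kernel (of_real r * z) (of_real s * z')
      = (1 - (r * s)\<^sup>2) / (cmod (1 - of_real (s * r) * u))\<^sup>2"
    using r z by (simp add: poisson_kernel_def norm_mult u_def mult_ac)
  also have "\<dots> \<le> (2 * (1 - r\<^sup>2)) / ((cmod (1 - of_real r * u))\<^sup>2 / 4)"
  proof (rule frac_le)
    have "r * r \<le> r * s" using r by (intro mult_left_mono) auto
    then have "(r * r)\<^sup>2 \<le> (r * s)\<^sup>2" using r by (intro power_mono) auto
    moreover have "(1 - r\<^sup>2) * r\<^sup>2 \<le> (1 - r\<^sup>2) * 1"
      using r by (intro mult_left_mono) (auto simp: abs_square_le_1 power_le_one)
    ultimately show "1 - (r * s)\<^sup>2 \<le> 2 * (1 - r\<^sup>2)" by (simp add: algebra_simps power2_eq_square)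
    show "(cmod (1 - of_real r * u))\<^sup>2 / 4 \<le> (cmod (1 - of_real (s * r) * u))\<^sup>2"
      using power_mono[OF denominators, of 2] by (simp add: power_mult_distrib)
  qed (use r \<open>0 < cmod (1 - of_real r * u)\<close> in \<open>auto simp: power_le_one\<close>)
  also have "\<dots> = 8 * poisson_kernel (of_real r * z) z'"
    using r z by (simp add: poisson_kernel_def norm_mult u_def mult_ac)
  finally show ?thesis .
qed

lemma poisson_kernel_le_radial_projections:
  assumes z: "cmod z = 1" "cmod z' = 1" and r: "0 \<le> r" "r < 1" "0 \<le> s" "s < 1"
  shows "poisson_kernel (of_real r * z) (of_real s * z')
    \<le> 8 * (poisson_kernel (of_real r * z) z' + poisson_kernel (of_real s * z') z)"
proof -
  have "0 \<le> poisson_kernel (of_real r * z) z'" "0 \<le> poisson_kernel (of_real s * z') z"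
    using z r by (auto intro!: poisson_kernel_nonneg simp: norm_mult)
  then show ?thesis
    using poisson_kernel_le_smaller_radius[of z z' r s] poisson_kernel_le_smaller_radius[of z' z s r]
      poisson_kernel_commute[of "of_real r * z" "of_real s * z'"] z r
    by (cases "r \<le> s") (simp_all add: algebra_simps)
qed

section \<open>The radial maximal inequality\<close>

text \<open>
  A \<open>TT\<^sup>*\<close> argument. The semigroup property turns the square of the \<open>L\<^sup>2\<close> norm of \<open>kernel_mass\<close>
  into a double integral of \<open>P(\<rho>(z)z, \<rho>(z')z')\<close>; comparing kernels bounds it by \<open>16\<close> times the
  integral of \<open>kernel_mass\<close> over \<open>E\<close>, and Cauchy--Schwarz closes the loop. The bound \<open>R\<close> serves
  only to make the quantity that is cancelled finite.
\<close>

locale radial_selection =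
  fixes \<rho> :: "complex \<Rightarrow> real" and E :: "complex set" and R :: real
  assumes measurable_radius [measurable]: "\<rho> \<in> borel_measurable borel"
    and measurable_selection [measurable]: "E \<in> sets borel"
    and radius_nonneg: "\<And>z. 0 \<le> \<rho> z" and radius_le: "\<And>z. \<rho> z \<le> R" and R_less_1: "R < 1"
begin

definition kernel :: "complex \<Rightarrow> complex \<Rightarrow> ennreal" where
  "kernel w z = indicator E z * ennreal (poisson_kernel (of_real (\<rho> z) * z) w)"

definition kernel_mass :: "complex \<Rightarrow> ennreal" where
  "kernel_mass w = (\<integral>\<^sup>+z. kernel w z \<partial>circle_measure)"

lemma measurable_kernel [measurable (raw)]:
  assumes [measurable]: "f \<in> borel_measurable M" "g \<in> borel_measurable M"
  shows "(\<lambda>x. kernel (f x) (g x)) \<in> borel_measurable M"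
  unfolding kernel_def by measurable

lemma measurable_kernel_mass [measurable]: "kernel_mass \<in> borel_measurable borel"
  unfolding kernel_mass_def by measurable

lemma norm_selected_point_le: "cmod z = 1 \<Longrightarrow> cmod (of_real (\<rho> z) * z) \<le> R"
  using radius_nonneg radius_le by (simp add: norm_mult)

lemma norm_selected_point_less_1: "cmod z = 1 \<Longrightarrow> cmod (of_real (\<rho> z) * z) < 1"
  using norm_selected_point_le R_less_1 by (meson le_less_trans)

lemma integral_kernel_product_le:
  assumes z: "cmod z = 1" and z': "cmod z' = 1"
  shows "(\<integral>\<^sup>+w. kernel w z * kernel w z' \<partial>circle_measure)
    \<le> 8 * (indicator E z' * kernel z' z) + 8 * (indicator E z * kernel z z')"
proof -
  let ?a = "of_real (\<rho> z) * z" and ?b = "of_real (\<rho> z') * z'"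
  let ?I = "indicator E z * indicator E z' :: ennreal"
  have "(\<integral>\<^sup>+w. kernel w z * kernel w z' \<partial>circle_measure) =
      (\<integral>\<^sup>+w. ?I * (ennreal (poisson_kernel ?a w) * ennreal (poisson_kernel ?b w)) \<partial>circle_measure)"
    unfolding kernel_def by (simp add: mult_ac)
  also have "\<dots> = ?I * ennreal (poisson_kernel ?a ?b)"
    by (simp add: nn_integral_cmult nn_integral_poisson_kernel_semigroup norm_selected_point_less_1 z z')
  also have "\<dots> \<le> ?I * ennreal (8 * (poisson_kernel ?a z' + poisson_kernel ?b z))"
    using radius_nonneg le_less_trans[OF radius_le R_less_1]
    by (intro mult_left_mono ennreal_leI poisson_kernel_le_radial_projections z z') auto
  also have "\<dots> = 8 * (indicator E z' * kernel z' z) + 8 * (indicator E z * kernel z z')"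
    unfolding kernel_def
    using poisson_kernel_nonneg[of ?a z'] poisson_kernel_nonneg[of ?b z]
      norm_selected_point_less_1[OF z] norm_selected_point_less_1[OF z'] z z'
    by (simp add: ennreal_mult ennreal_plus distrib_left mult_ac split: split_indicator)
  finally show ?thesis .
qed

lemma integral_kernel_mass_square_le:
  "(\<integral>\<^sup>+w. (kernel_mass w)\<^sup>2 \<partial>circle_measure)
    \<le> 16 * (\<integral>\<^sup>+z. indicator E z * kernel_mass z \<partial>circle_measure)"
proof -
  let ?M = circle_measure
  let ?k = "\<lambda>z z'. 8 * (indicator E z' * kernel z' z)"
  have "(\<integral>\<^sup>+w. (kernel_mass w)\<^sup>2 \<partial>?M) = (\<integral>\<^sup>+w. \<integral>\<^sup>+z. \<integral>\<^sup>+z'. kernel w z * kernel w z' \<partial>?M \<partial>?M \<partial>?M)"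
    unfolding kernel_mass_def power2_eq_square by (simp add: nn_integral_cmult nn_integral_multc)
  also have "\<dots> = (\<integral>\<^sup>+z. \<integral>\<^sup>+w. \<integral>\<^sup>+z'. kernel w z * kernel w z' \<partial>?M \<partial>?M \<partial>?M)"
    by (rule circle_pair.Fubini') measurable
  also have "\<dots> = (\<integral>\<^sup>+z. \<integral>\<^sup>+z'. \<integral>\<^sup>+w. kernel w z * kernel w z' \<partial>?M \<partial>?M \<partial>?M)"
    by (intro nn_integral_cong circle_pair.Fubini') measurable
  also have "\<dots> \<le> (\<integral>\<^sup>+z. \<integral>\<^sup>+z'. ?k z z' + ?k z' z \<partial>?M \<partial>?M)"
    by (intro nn_integral_mono_AE AE_circleI integral_kernel_product_le)
  also have "\<dots> = (\<integral>\<^sup>+z. \<integral>\<^sup>+z'. ?k z z' \<partial>?M \<partial>?M) + (\<integral>\<^sup>+z. \<integral>\<^sup>+z'. ?k z' z \<partial>?M \<partial>?M)"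
    by (simp add: nn_integral_add)
  also have "(\<integral>\<^sup>+z. \<integral>\<^sup>+z'. ?k z z' \<partial>?M \<partial>?M) = (\<integral>\<^sup>+z'. \<integral>\<^sup>+z. ?k z z' \<partial>?M \<partial>?M)"
    by (rule circle_pair.Fubini') measurable
  finally show ?thesis
    by (simp add: nn_integral_cmult kernel_mass_def distrib_right[symmetric])
qed

lemma kernel_mass_le:
  assumes "cmod w = 1"
  shows "kernel_mass w \<le> ennreal (1 / (1 - R)\<^sup>2)"
proof -
  have "kernel_mass w \<le> (\<integral>\<^sup>+z. ennreal (1 / (1 - R)\<^sup>2) \<partial>circle_measure)"
    unfolding kernel_mass_def
  proof (intro nn_integral_mono_AE AE_circleI)
    show "kernel w z \<le> ennreal (1 / (1 - R)\<^sup>2)" if "cmod z = 1" for z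
      unfolding kernel_def
      using poisson_kernel_le[OF norm_selected_point_le[OF that] R_less_1 assms]
      by (auto split: split_indicator intro!: ennreal_leI)
  qed
  then show ?thesis by simp
qed

lemma integral_kernel_mass_square_le_measure:
  "(\<integral>\<^sup>+w. (kernel_mass w)\<^sup>2 \<partial>circle_measure) \<le> 256 * emeasure circle_measure E"
proof -
  let ?M = circle_measure
  define B where "B = (\<integral>\<^sup>+w. (kernel_mass w)\<^sup>2 \<partial>?M)"
  have "(\<lambda>z. (indicator E z)\<^sup>2 :: ennreal) = indicator E"
    by (auto simp: fun_eq_iff split: split_indicator)
  then have "(\<integral>\<^sup>+z. (indicator E z)\<^sup>2 \<partial>?M) = emeasure ?M E"
    by simp
  then have "(\<integral>\<^sup>+z. indicator E z * kernel_mass z \<partial>?M)\<^sup>2 \<le> emeasure ?M E * B"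
    using Cauchy_Schwarz_nn_integral[of "indicator E" ?M kernel_mass] by (simp add: B_def)
  then have "256 * (\<integral>\<^sup>+z. indicator E z * kernel_mass z \<partial>?M)\<^sup>2 \<le> 256 * (emeasure ?M E * B)"
    by (rule mult_left_mono) simp
  moreover have "B\<^sup>2 \<le> (16 * (\<integral>\<^sup>+z. indicator E z * kernel_mass z \<partial>?M))\<^sup>2"
    unfolding B_def by (intro power_mono integral_kernel_mass_square_le) simp
  ultimately have "B\<^sup>2 \<le> 256 * (emeasure ?M E * B)"
    by (simp add: power_mult_distrib)
  then have "B * B \<le> B * (256 * emeasure ?M E)"
    by (simp add: power2_eq_square mult_ac)
  moreover have "B < top"
  proof -
    have "B \<le> (\<integral>\<^sup>+w. (ennreal (1 / (1 - R)\<^sup>2))\<^sup>2 \<partial>?M)"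
      unfolding B_def by (intro nn_integral_mono_AE AE_circleI power_mono kernel_mass_le) auto
    also have "\<dots> < top" by (simp add: power_less_top_ennreal)
    finally show ?thesis .
  qed
  ultimately show ?thesis
    unfolding B_def[symmetric] by (cases "B = 0") (auto simp: ennreal_mult_le_mult_iff)
qed

lemma measure_selection_le_integral:
  fixes h :: "complex \<Rightarrow> complex"
  assumes [measurable]: "h \<in> borel_measurable borel"
    and cont: "continuous_on (cball 0 1) h" and hol: "h holomorphic_on ball 0 1"
    and large: "\<And>z. z \<in> E \<Longrightarrow> cmod z = 1 \<Longrightarrow> lam \<le> cmod (h (of_real (\<rho> z) * z))"
  shows "ennreal lam * emeasure circle_measure E
    \<le> (\<integral>\<^sup>+w. ennreal (cmod (h w)) * kernel_mass w \<partial>circle_measure)"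
proof -
  let ?M = circle_measure
  have pointwise: "ennreal lam * indicator E z \<le> (\<integral>\<^sup>+w. kernel w z * ennreal (cmod (h w)) \<partial>?M)"
    if z: "cmod z = 1" for z
  proof (cases "z \<in> E")
    case True
    let ?a = "of_real (\<rho> z) * z"
    note a = norm_selected_point_less_1[OF z]
    have "ennreal lam \<le> ennreal (cmod (h ?a))"
      by (intro ennreal_leI large True z)
    also have "h ?a = (\<integral>w. complex_of_real (poisson_kernel ?a w) * h w \<partial>?M)"
      by (rule poisson_integral[OF _ cont hol a, symmetric]) simp
    also have "ennreal (cmod \<dots>) \<le> (\<integral>\<^sup>+w. ennreal (cmod (complex_of_real (poisson_kernel ?a w) * h w)) \<partial>?M)"
      by (intro integral_norm_bound_ennreal integrable_circle_continuous)
        (auto intro!: continuous_intros continuous_on_poisson_kernel a continuous_on_subset[OF cont])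
    also have "\<dots> = (\<integral>\<^sup>+w. kernel w z * ennreal (cmod (h w)) \<partial>?M)"
      using True a poisson_kernel_nonneg[of ?a]
      by (intro nn_integral_cong_AE AE_circleI) (simp add: kernel_def norm_mult ennreal_mult)
    finally show ?thesis using True by simp
  qed simp
  have "ennreal lam * emeasure ?M E = (\<integral>\<^sup>+z. ennreal lam * indicator E z \<partial>?M)"
    by (simp add: nn_integral_cmult_indicator)
  also have "\<dots> \<le> (\<integral>\<^sup>+z. \<integral>\<^sup>+w. kernel w z * ennreal (cmod (h w)) \<partial>?M \<partial>?M)"
    by (intro nn_integral_mono_AE AE_circleI pointwise)
  also have "\<dots> = (\<integral>\<^sup>+w. \<integral>\<^sup>+z. kernel w z * ennreal (cmod (h w)) \<partial>?M \<partial>?M)"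
    by (rule circle_pair.Fubini') measurable
  also have "\<dots> = (\<integral>\<^sup>+w. ennreal (cmod (h w)) * kernel_mass w \<partial>?M)"
    unfolding mult.commute[of "ennreal _"] by (simp add: nn_integral_multc kernel_mass_def)
  finally show ?thesis .
qed

theorem radial_maximal_inequality:
  fixes h :: "complex \<Rightarrow> complex"
  assumes [measurable]: "h \<in> borel_measurable borel"
    and cont: "continuous_on (cball 0 1) h" and hol: "h holomorphic_on ball 0 1"
    and lam: "0 \<le> lam"
    and large: "\<And>z. z \<in> E \<Longrightarrow> cmod z = 1 \<Longrightarrow> lam \<le> cmod (h (of_real (\<rho> z) * z))"
  shows "ennreal (lam\<^sup>2) * emeasure circle_measure E
    \<le> 256 * (\<integral>\<^sup>+w. ennreal ((cmod (h w))\<^sup>2) \<partial>circle_measure)"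
proof -
  let ?M = circle_measure
  define H where "H = (\<integral>\<^sup>+w. ennreal ((cmod (h w))\<^sup>2) \<partial>?M)"
  have "(ennreal lam * emeasure ?M E)\<^sup>2 \<le> (\<integral>\<^sup>+w. ennreal (cmod (h w)) * kernel_mass w \<partial>?M)\<^sup>2"
    by (intro power_mono measure_selection_le_integral cont hol large) auto
  also have "\<dots> \<le> (\<integral>\<^sup>+w. (ennreal (cmod (h w)))\<^sup>2 \<partial>?M) * (\<integral>\<^sup>+w. (kernel_mass w)\<^sup>2 \<partial>?M)"
    by (rule Cauchy_Schwarz_nn_integral) measurable
  also have "\<dots> \<le> H * (256 * emeasure ?M E)"
    unfolding H_def by (intro mult_mono integral_kernel_mass_square_le_measure) (auto simp: ennreal_power)
  finally have "emeasure ?M E * (ennreal (lam\<^sup>2) * emeasure ?M E) \<le> emeasure ?M E * (256 * H)"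
    using lam by (simp add: power2_eq_square mult_ac ennreal_mult)
  then show ?thesis
    unfolding H_def[symmetric]
    by (cases "emeasure ?M E = 0") (auto simp: ennreal_mult_le_mult_iff circle.emeasure_eq_measure)
qed

end

section \<open>Power series with square-summable coefficients\<close>

lemma circle_power_mult_cnj_power:
  assumes "cmod z = 1" "n \<le> m"
  shows "z ^ m * cnj (z ^ n) = z ^ (m - n)"
proof -
  have "z ^ n * cnj (z ^ n) = 1"
    using assms by (simp add: complex_norm_square[symmetric] norm_power del: complex_cnj_power)
  moreover have "z ^ m = z ^ (m - n) * z ^ n"
    using assms by (simp add: power_add[symmetric])
  ultimately show ?thesis
    by (simp add: mult.assoc del: complex_cnj_power)
qed

lemma integral_power_circle: "(\<integral>z. z ^ n \<partial>circle_measure) = (if n = 0 then 1 else 0)"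
  by (subst mean_value_circle_measure)
    (auto intro!: continuous_intros holomorphic_intros simp: power_0_left)

lemma integral_power_mult_cnj_power:
  "(\<integral>z. z ^ m * cnj (z ^ n) \<partial>circle_measure) = (if m = n then 1 else 0)"
proof -
  have le: "(\<integral>z. z ^ m * cnj (z ^ n) \<partial>circle_measure) = (if m = n then 1 else 0)" if "n \<le> m" for m n :: nat
  proof -
    have "(\<integral>z. z ^ m * cnj (z ^ n) \<partial>circle_measure) = (\<integral>z. z ^ (m - n) \<partial>circle_measure)"
      by (rule integral_circle_cong) (use circle_power_mult_cnj_power[OF _ that] in auto)
    then show ?thesis using that by (simp add: integral_power_circle)
  qed
  show ?thesis
  proof (cases "n \<le> m")
    case False
    have "(\<integral>z. z ^ m * cnj (z ^ n) \<partial>circle_measure) = cnj (\<integral>z. z ^ n * cnj (z ^ m) \<partial>circle_measure)"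
      unfolding Bochner_Integration.integral_cnj[symmetric] by (simp add: mult.commute)
    then show ?thesis using le[of m n] False by auto
  qed (rule le)
qed

lemma Parseval_polynomial:
  fixes c :: "nat \<Rightarrow> complex"
  shows "(\<integral>z. (cmod (\<Sum>n<N. c n * z ^ n))\<^sup>2 \<partial>circle_measure) = (\<Sum>n<N. (cmod (c n))\<^sup>2)"
proof -
  have integrable: "integrable circle_measure (\<lambda>z. c m * z ^ m * cnj (c n * z ^ n))" for m n
    by (rule integrable_circle_continuous) (measurable, intro continuous_intros)
  have "complex_of_real (\<integral>z. (cmod (\<Sum>n<N. c n * z ^ n))\<^sup>2 \<partial>circle_measure)
      = (\<integral>z. complex_of_real ((cmod (\<Sum>n<N. c n * z ^ n))\<^sup>2) \<partial>circle_measure)"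
    by (rule integral_complex_of_real[symmetric])
  also have "\<dots> = (\<integral>z. (\<Sum>m<N. \<Sum>n<N. c m * z ^ m * cnj (c n * z ^ n)) \<partial>circle_measure)"
    by (simp only: complex_norm_square cnj_sum sum_product)
  also have "\<dots> = (\<Sum>m<N. \<Sum>n<N. \<integral>z. c m * z ^ m * cnj (c n * z ^ n) \<partial>circle_measure)"
    using integrable by (simp add: Bochner_Integration.integral_sum)
  also have "\<dots> = (\<Sum>m<N. \<Sum>n<N. c m * cnj (c n) * (\<integral>z. z ^ m * cnj (z ^ n) \<partial>circle_measure))"
    by (intro sum.cong refl, subst integral_mult_right_zero[symmetric]) (simp add: mult_ac)
  also have "\<dots> = (\<Sum>m<N. complex_of_real ((cmod (c m))\<^sup>2))"
    unfolding integral_power_mult_cnj_power complex_norm_square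
    by (intro sum.cong refl) (simp add: if_distrib sum.delta cong: if_cong)
  finally show ?thesis
    by (simp only: of_real_sum[symmetric] of_real_eq_iff)
qed

definition powser :: "(nat \<Rightarrow> complex) \<Rightarrow> complex \<Rightarrow> complex" where
  "powser c w = (\<Sum>n. c n * w ^ n)"

lemma measurable_powser [measurable]: "powser c \<in> borel_measurable borel"
  unfolding powser_def by measurable

lemma powser_dilation: "powser c (a * w) = powser (\<lambda>n. c n * a ^ n) w"
  by (simp add: powser_def power_mult_distrib mult.assoc)

lemma Parseval_powser:
  assumes c: "summable (\<lambda>n. cmod (c n))"
  shows "(\<lambda>n. (cmod (c n))\<^sup>2) sums (\<integral>z. (cmod (powser c z))\<^sup>2 \<partial>circle_measure)"
proof -
  let ?C = "\<Sum>n. cmod (c n)"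
  have "(\<lambda>N. \<integral>z. (cmod (\<Sum>n<N. c n * z ^ n))\<^sup>2 \<partial>circle_measure)
      \<longlonglongrightarrow> (\<integral>z. (cmod (powser c z))\<^sup>2 \<partial>circle_measure)"
  proof (rule integral_dominated_convergence[where w = "\<lambda>_. ?C\<^sup>2"])
    show "AE z in circle_measure. (\<lambda>N. (cmod (\<Sum>n<N. c n * z ^ n))\<^sup>2) \<longlonglongrightarrow> (cmod (powser c z))\<^sup>2"
    proof (rule AE_circleI)
      fix z :: complex assume "cmod z = 1"
      then have "summable (\<lambda>n. c n * z ^ n)"
        by (intro summable_norm_cancel[of "\<lambda>n. c n * z ^ n"]) (simp add: c norm_mult norm_power)
      then show "(\<lambda>N. (cmod (\<Sum>n<N. c n * z ^ n))\<^sup>2) \<longlonglongrightarrow> (cmod (powser c z))\<^sup>2"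
        unfolding powser_def by (intro tendsto_intros summable_LIMSEQ)
    qed
    show "AE z in circle_measure. norm ((cmod (\<Sum>n<N. c n * z ^ n))\<^sup>2) \<le> ?C\<^sup>2" for N
    proof (rule AE_circleI)
      fix z :: complex assume "cmod z = 1"
      then have "cmod (\<Sum>n<N. c n * z ^ n) \<le> (\<Sum>n<N. cmod (c n))"
        using norm_sum[of "\<lambda>n. c n * z ^ n" "{..<N}"] by (simp add: norm_mult norm_power)
      also have "\<dots> \<le> ?C" by (rule sum_le_suminf[OF c]) auto
      finally show "norm ((cmod (\<Sum>n<N. c n * z ^ n))\<^sup>2) \<le> ?C\<^sup>2"
        by (simp add: power_mono)
    qed
  qed auto
  then show ?thesis
    by (simp add: Parseval_polynomial sums_def)
qed

abbreviation square_summable :: "(nat \<Rightarrow> complex) \<Rightarrow> bool" where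
  "square_summable c \<equiv> summable (\<lambda>n. (cmod (c n))\<^sup>2)"

lemma summable_norm_powser:
  assumes c: "square_summable c" and w: "cmod w < 1"
  shows "summable (\<lambda>n. cmod (c n * w ^ n))"
proof (rule summable_comparison_test')
  show "summable (\<lambda>n. (cmod (c n))\<^sup>2 + ((cmod w)\<^sup>2) ^ n)"
    using w by (intro summable_add c summable_geometric) (simp add: power_less_one_iff)
  show "norm (cmod (c n * w ^ n)) \<le> (cmod (c n))\<^sup>2 + ((cmod w)\<^sup>2) ^ n" for n
  proof -
    have "0 \<le> cmod (c n) * cmod w ^ n" by simp
    then have "cmod (c n) * cmod w ^ n \<le> (cmod (c n))\<^sup>2 + (cmod w ^ n)\<^sup>2"
      using sum_squares_bound[of "cmod (c n)" "cmod w ^ n"] by linarith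
    then show ?thesis
      by (simp add: norm_mult norm_power power_mult[symmetric] mult.commute)
  qed
qed

lemma powser_sums:
  "square_summable c \<Longrightarrow> cmod w < 1 \<Longrightarrow> (\<lambda>n. c n * w ^ n) sums powser c w"
  unfolding powser_def by (rule summable_sums[OF summable_norm_cancel[OF summable_norm_powser]])

lemma holomorphic_on_powser: "square_summable c \<Longrightarrow> powser c holomorphic_on ball 0 1"
  by (rule power_series_holomorphic[where a = c]) (simp add: powser_sums)

lemma norm_dilation_less_1: "cmod w \<le> 1 \<Longrightarrow> 0 \<le> r \<Longrightarrow> r < 1 \<Longrightarrow> cmod (of_real r * w) < 1"
  using mult_left_le[of "cmod w" r] by (simp add: norm_mult)

lemma holomorphic_on_dilation:
  assumes "f holomorphic_on ball 0 1" "0 \<le> r" "r < 1"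
  shows "(\<lambda>w. f (of_real r * w)) holomorphic_on ball 0 1"
proof -
  have "(\<lambda>w. complex_of_real r * w) ` ball 0 1 \<subseteq> ball 0 1"
    using norm_dilation_less_1[OF _ assms(2,3)] by (auto simp: less_imp_le)
  then show ?thesis
    using holomorphic_on_compose_gen[OF _ assms(1), of "\<lambda>w. of_real r * w" "ball 0 1"]
    by (auto simp: o_def intro!: holomorphic_intros)
qed

lemma continuous_on_dilation:
  assumes "f holomorphic_on ball 0 1" "0 \<le> r" "r < 1"
  shows "continuous_on (cball 0 1) (\<lambda>w. f (of_real r * w))"
  by (rule continuous_on_compose2[OF holomorphic_on_imp_continuous_on[OF assms(1)]])
    (use assms in \<open>auto intro!: continuous_intros simp: norm_dilation_less_1\<close>)

lemma nn_integral_powser_le: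
  assumes c: "square_summable c" and r: "0 \<le> r" "r < 1"
  shows "(\<integral>\<^sup>+z. ennreal ((cmod (powser c (of_real r * z)))\<^sup>2) \<partial>circle_measure) \<le> ennreal (\<Sum>n. (cmod (c n))\<^sup>2)"
proof -
  have sums: "(\<lambda>n. (cmod (c n * of_real r ^ n))\<^sup>2)
      sums (\<integral>z. (cmod (powser c (of_real r * z)))\<^sup>2 \<partial>circle_measure)"
    unfolding powser_dilation
    by (rule Parseval_powser, rule summable_norm_powser[OF c]) (use r in simp)
  have cont: "continuous_on (cball 0 1) (\<lambda>z. powser c (of_real r * z))"
    by (rule continuous_on_dilation[OF holomorphic_on_powser[OF c] r])
  have "integrable circle_measure (\<lambda>z. (cmod (powser c (of_real r * z)))\<^sup>2)"
    by (rule integrable_circle_continuous) (auto intro!: continuous_intros continuous_on_subset[OF cont])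
  then have "(\<integral>\<^sup>+z. ennreal ((cmod (powser c (of_real r * z)))\<^sup>2) \<partial>circle_measure)
      = ennreal (\<Sum>n. (cmod (c n * of_real r ^ n))\<^sup>2)"
    using sums_unique[OF sums] by (simp add: nn_integral_eq_integral)
  also have "(\<Sum>n. (cmod (c n * of_real r ^ n))\<^sup>2) \<le> (\<Sum>n. (cmod (c n))\<^sup>2)"
    using r by (intro suminf_le sums_summable[OF sums] c power_mono)
      (auto simp: norm_mult norm_power intro!: mult_left_le power_le_one)
  finally show ?thesis by (simp add: ennreal_leI)
qed

section \<open>Fatou's theorem on radial limits\<close>

lemma powser_weak_type_sequence:
  assumes c: "square_summable c" and q: "\<And>i :: nat. 0 \<le> q i" "\<And>i. q i \<le> R" and R: "R < 1"
    and lam: "0 \<le> lam"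
  shows "ennreal (lam\<^sup>2) * emeasure circle_measure {z. \<exists>i. lam < cmod (powser c (of_real (q i) * z))}
    \<le> 256 * ennreal (\<Sum>n. (cmod (c n))\<^sup>2)"
proof -
  define E where "E = {z. \<exists>i. lam < cmod (powser c (of_real (q i) * z))}"
  have [measurable]: "E \<in> sets borel" unfolding E_def by measurable
  define S where "S = (1 + R) / 2"
  have S: "0 < S" "S < 1" "R < S" using q[of 0] R by (auto simp: S_def)
  define first where "first = (\<lambda>z. LEAST i. lam < cmod (powser c (of_real (q i) * z)))"
  have first: "lam < cmod (powser c (of_real (q (first z)) * z))" if "z \<in> E" for z
    using that unfolding E_def first_def by (auto intro: LeastI)
  have [measurable]: "first \<in> borel \<rightarrow>\<^sub>M count_space UNIV" unfolding first_def by measurable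
  have [measurable]: "(\<lambda>z. q (first z)) \<in> borel_measurable borel"
    by (rule measurable_compose[of first _ "count_space UNIV"]) auto
  define \<rho> where "\<rho> = (\<lambda>z. q (first z) / S)"
  interpret radial_selection \<rho> E "R / S"
    using q S by unfold_locales (auto simp: \<rho>_def divide_right_mono)
  have "ennreal (lam\<^sup>2) * emeasure circle_measure E
      \<le> 256 * (\<integral>\<^sup>+w. ennreal ((cmod (powser c (of_real S * w)))\<^sup>2) \<partial>circle_measure)"
  proof (rule radial_maximal_inequality)
    show "lam \<le> cmod (powser c (of_real S * (of_real (\<rho> z) * z)))" if "z \<in> E" for z
      using first[OF that] S by (simp add: \<rho>_def)
  qed (use S lam in \<open>auto intro!: continuous_on_dilation holomorphic_on_dilation holomorphic_on_powser c\<close>)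
  also have "\<dots> \<le> 256 * ennreal (\<Sum>n. (cmod (c n))\<^sup>2)"
    using S by (intro mult_left_mono nn_integral_powser_le c) auto
  finally show ?thesis by (simp add: E_def)
qed

definition radius_seq :: "nat \<Rightarrow> real" where
  "radius_seq k = 1 - inverse (real (Suc (Suc k)))"

lemma radius_seq_bounds: "0 < radius_seq k" "radius_seq k < 1"
  by (auto simp: radius_seq_def field_simps)

lemma incseq_radius_seq: "incseq radius_seq"
  by (auto simp: incseq_def radius_seq_def le_imp_inverse_le)

lemma radius_seq_tendsto: "radius_seq \<longlonglongrightarrow> 1"
proof -
  have "(\<lambda>k. 1 - inverse (real (Suc (Suc k)))) \<longlonglongrightarrow> 1 - 0"
    by (intro tendsto_diff tendsto_const LIMSEQ_Suc[OF LIMSEQ_inverse_real_of_nat])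
  then show ?thesis by (simp add: radius_seq_def[abs_def])
qed

lemma filterlim_radius_seq_at_left: "filterlim radius_seq (at_left 1) sequentially"
proof -
  have "radius_seq k \<in> {..<1} \<and> radius_seq k \<noteq> 1" for k
    using radius_seq_bounds(2)[of k] by simp
  then show ?thesis
    using radius_seq_tendsto by (simp add: filterlim_at)
qed

lemma measurable_powser_exceeds:
  assumes "countable Q"
  shows "{z. \<exists>r\<in>Q. lam < cmod (powser c (of_real r * z))} \<in> sets borel"
proof -
  have "(\<Union>r\<in>Q. {z. lam < cmod (powser c (of_real r * z))}) \<in> sets borel"
    using assms by (intro sets.countable_UN') auto
  also have "(\<Union>r\<in>Q. {z. lam < cmod (powser c (of_real r * z))})
      = {z. \<exists>r\<in>Q. lam < cmod (powser c (of_real r * z))}"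
    by blast
  finally show ?thesis .
qed

lemma powser_weak_type_le_radius:
  assumes c: "square_summable c" and Q: "countable Q" "Q \<subseteq> {0..R}" and R: "R < 1" and lam: "0 \<le> lam"
  shows "ennreal (lam\<^sup>2) * emeasure circle_measure {z. \<exists>r\<in>Q. lam < cmod (powser c (of_real r * z))}
    \<le> 256 * ennreal (\<Sum>n. (cmod (c n))\<^sup>2)"
proof (cases "Q = {}")
  case False
  define q where "q = from_nat_into Q"
  have range_q: "range q = Q"
    unfolding q_def by (rule range_from_nat_into[OF False Q(1)])
  then have q: "0 \<le> q i" "q i \<le> R" for i
    using Q(2) rangeI[of q i] by auto
  have "{z. \<exists>r\<in>Q. lam < cmod (powser c (of_real r * z))}
      = {z. \<exists>i. lam < cmod (powser c (of_real (q i) * z))}"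
    unfolding range_q[symmetric] by simp
  then show ?thesis
    by (simp only: powser_weak_type_sequence[OF c q R lam])
qed simp

lemma powser_weak_type:
  assumes c: "square_summable c" and Q: "countable Q" "Q \<subseteq> {0<..<1}" and lam: "0 \<le> lam"
  shows "ennreal (lam\<^sup>2) * emeasure circle_measure {z. \<exists>r\<in>Q. lam < cmod (powser c (of_real r * z))}
    \<le> 256 * ennreal (\<Sum>n. (cmod (c n))\<^sup>2)"
proof -
  define E where "E = (\<lambda>k. {z. \<exists>r\<in>Q \<inter> {..radius_seq k}. lam < cmod (powser c (of_real r * z))})"
  have "\<exists>k. r \<le> radius_seq k" if "r \<in> Q" for r
  proof -
    have "\<forall>\<^sub>F k in sequentially. r < radius_seq k"
      using Q(2) that by (intro order_tendstoD(1)[OF radius_seq_tendsto]) auto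
    then show ?thesis
      by (auto simp: eventually_sequentially intro: less_imp_le)
  qed
  then have union: "{z. \<exists>r\<in>Q. lam < cmod (powser c (of_real r * z))} = (\<Union>k. E k)"
    unfolding E_def by fastforce
  have "incseq E"
  proof (intro incseq_SucI subsetI)
    fix k z assume "z \<in> E k"
    moreover have "radius_seq k \<le> radius_seq (Suc k)"
      by (rule incseq_SucD[OF incseq_radius_seq])
    ultimately show "z \<in> E (Suc k)"
      unfolding E_def by (auto intro: order_trans)
  qed
  moreover have "E k \<in> sets borel" for k
    unfolding E_def using Q(1) by (intro measurable_powser_exceeds) simp
  ultimately have limit: "emeasure circle_measure (\<Union>k. E k) = (SUP k. emeasure circle_measure (E k))"
    by (intro SUP_emeasure_incseq[symmetric]) auto
  have "Q \<inter> {..radius_seq k} \<subseteq> {0..radius_seq k}" for k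
    using Q(2) by (auto dest: subsetD)
  then have "ennreal (lam\<^sup>2) * emeasure circle_measure (E k) \<le> 256 * ennreal (\<Sum>n. (cmod (c n))\<^sup>2)" for k
    unfolding E_def using Q(1) by (intro powser_weak_type_le_radius[OF c _ _ radius_seq_bounds(2) lam]) auto
  then show ?thesis
    unfolding union limit SUP_mult_left_ennreal by (rule SUP_least)
qed

definition coeff_tail :: "nat \<Rightarrow> (nat \<Rightarrow> complex) \<Rightarrow> nat \<Rightarrow> complex" where
  "coeff_tail N c n = (if n < N then 0 else c n)"

lemma square_summable_coeff_tail: "square_summable c \<Longrightarrow> square_summable (coeff_tail N c)"
  by (erule summable_comparison_test'[where N = 0]) (auto simp: coeff_tail_def)

lemma powser_coeff_tail:
  assumes c: "square_summable c" and w: "cmod w < 1"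
  shows "powser c w = (\<Sum>n<N. c n * w ^ n) + powser (coeff_tail N c) w"
proof -
  have "(\<lambda>n. (if n \<in> {..<N} then c n * w ^ n else 0) + coeff_tail N c n * w ^ n)
      sums ((\<Sum>n<N. c n * w ^ n) + powser (coeff_tail N c) w)"
    by (intro sums_add sums_If_finite_set powser_sums square_summable_coeff_tail c w) simp
  also have "(\<lambda>n. (if n \<in> {..<N} then c n * w ^ n else 0) + coeff_tail N c n * w ^ n) = (\<lambda>n. c n * w ^ n)"
    by (auto simp: coeff_tail_def)
  finally show ?thesis by (simp add: powser_def sums_iff)
qed

lemma suminf_coeff_tail_tendsto_0:
  assumes "square_summable c"
  shows "(\<lambda>N. \<Sum>n. (cmod (coeff_tail N c n))\<^sup>2) \<longlonglongrightarrow> 0"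
proof -
  have "(\<Sum>n. (cmod (coeff_tail N c n))\<^sup>2) = (\<Sum>n. (cmod (c (n + N)))\<^sup>2)" for N
  proof -
    have "(\<Sum>n. (cmod (coeff_tail N c n))\<^sup>2)
        = (\<Sum>n. (cmod (coeff_tail N c (n + N)))\<^sup>2) + (\<Sum>n<N. (cmod (coeff_tail N c n))\<^sup>2)"
      by (rule suminf_split_initial_segment[OF square_summable_coeff_tail[OF assms]])
    then show ?thesis by (simp add: coeff_tail_def)
  qed
  then show ?thesis
    by (simp only: suminf_exist_split2[OF assms])
qed

lemma AE_powser_coeff_tail_le:
  assumes c: "square_summable c" and Q: "countable Q" "Q \<subseteq> {0<..<1}" and lam: "0 < lam"
  shows "AE z in circle_measure. \<exists>N. \<forall>r\<in>Q. cmod (powser (coeff_tail N c) (of_real r * z)) \<le> lam"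
proof -
  define E where "E = (\<lambda>N. {z. \<exists>r\<in>Q. lam < cmod (powser (coeff_tail N c) (of_real r * z))})"
  define Z where "Z = (\<Inter>N. E N)"
  have [measurable]: "E N \<in> sets borel" for N
    unfolding E_def using Q(1) by (rule measurable_powser_exceeds)
  have [measurable]: "Z \<in> sets borel" unfolding Z_def by measurable
  have "ennreal (lam\<^sup>2) * emeasure circle_measure Z \<le> 256 * ennreal (\<Sum>n. (cmod (coeff_tail N c n))\<^sup>2)" for N
  proof -
    have "ennreal (lam\<^sup>2) * emeasure circle_measure Z \<le> ennreal (lam\<^sup>2) * emeasure circle_measure (E N)"
      by (intro mult_left_mono emeasure_mono) (auto simp: Z_def)
    also have "\<dots> \<le> 256 * ennreal (\<Sum>n. (cmod (coeff_tail N c n))\<^sup>2)"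
      unfolding E_def using lam by (intro powser_weak_type square_summable_coeff_tail c Q) simp
    finally show ?thesis .
  qed
  moreover have "(\<lambda>N. 256 * ennreal (\<Sum>n. (cmod (coeff_tail N c n))\<^sup>2)) \<longlonglongrightarrow> 256 * ennreal 0"
    by (intro ennreal_tendsto_cmult tendsto_ennrealI suminf_coeff_tail_tendsto_0 c) simp
  ultimately have "ennreal (lam\<^sup>2) * emeasure circle_measure Z \<le> 256 * ennreal 0"
    by (intro LIMSEQ_le_const) auto
  then have "emeasure circle_measure Z = 0" using lam by simp
  then have "AE z in circle_measure. z \<notin> Z"
    by (intro AE_not_in) (auto simp: null_sets_def)
  then show ?thesis
    by eventually_elim (auto simp: Z_def E_def not_less)
qed

lemma powser_le_on_radius_if_rational:
  assumes c: "square_summable c" and z: "cmod z = 1"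
    and le: "\<And>r. r \<in> \<rat> \<inter> {0<..<1} \<Longrightarrow> cmod (powser c (of_real r * z)) \<le> lam"
    and r: "0 < r" "r < 1"
  shows "cmod (powser c (of_real r * z)) \<le> lam"
proof (rule ccontr)
  define X where "X = {0<..<1::real} \<inter> (\<lambda>s. cmod (powser c (of_real s * z))) -` {lam<..}"
  assume "\<not> ?thesis"
  then have "r \<in> X" using r by (simp add: X_def not_le)
  have "continuous_on (ball 0 1) (powser c)"
    by (intro holomorphic_on_imp_continuous_on holomorphic_on_powser c)
  then have "continuous_on {0<..<1::real} (\<lambda>s. cmod (powser c (of_real s * z)))"
    by (intro continuous_on_norm, elim continuous_on_compose2)
      (auto intro!: continuous_intros simp: norm_mult z)
  then have "open X"
    unfolding X_def by (rule continuous_open_preimage) auto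
  with \<open>r \<in> X\<close> obtain d where "0 < d" "ball r d \<subseteq> X"
    by (auto simp: open_contains_ball)
  moreover obtain s where "s \<in> \<rat>" "r < s" "s < r + d"
    using Rats_dense_in_real[of r "r + d"] \<open>0 < d\<close> by auto
  ultimately have "s \<in> X" by (auto simp: dist_real_def)
  with le[of s] \<open>s \<in> \<rat>\<close> show False by (simp add: X_def)
qed

lemma powser_radial_limit_if_tails_small:
  assumes c: "square_summable c" and z: "cmod z = 1"
    and small: "\<And>e. 0 < e \<Longrightarrow> \<exists>N. \<forall>r\<in>\<rat> \<inter> {0<..<1}. cmod (powser (coeff_tail N c) (of_real r * z)) < e"
  shows "\<exists>l. ((\<lambda>r. powser c (of_real r * z)) \<longlongrightarrow> l) (at_left (1::real))"
proof -
  let ?F = "\<lambda>r::real. powser c (of_real r * z)"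
  have "cauchy_filter (filtermap ?F (at_left 1))"
    unfolding cauchy_filter_metric_filtermap
  proof (intro allI impI)
    fix e :: real assume e: "0 < e"
    have "0 < e / 4" using e by simp
    then obtain N where N: "\<forall>r\<in>\<rat> \<inter> {0<..<1}. cmod (powser (coeff_tail N c) (of_real r * z)) < e / 4"
      using small by blast
    define p where "p = (\<lambda>r::real. \<Sum>n<N. c n * (of_real r * z) ^ n)"
    define near where "near = (\<lambda>r::real. r \<in> {0<..<1} \<and> dist (p r) (p 1) < e / 4)"
    have "(p \<longlongrightarrow> p 1) (at_left 1)"
      unfolding p_def by (intro tendsto_intros)
    then have "\<forall>\<^sub>F r in at_left 1. dist (p r) (p 1) < e / 4"
      using e by (intro tendstoD[of p "p 1"]) auto
    then have ev: "eventually near (at_left 1)"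
      unfolding near_def by (rule eventually_conj[OF eventually_at_left_real[OF zero_less_one]])
    have F_near: "dist (?F r) (p 1) < e / 2" if "near r" for r
    proof -
      have "dist (?F r) (p r) = cmod (powser (coeff_tail N c) (of_real r * z))"
        using powser_coeff_tail[OF c, of "of_real r * z" N] that z
        by (simp add: p_def dist_norm near_def norm_mult)
      also have "\<dots> \<le> e / 4"
        by (rule powser_le_on_radius_if_rational[OF square_summable_coeff_tail[OF c] z])
          (use that N in \<open>auto simp: near_def intro: less_imp_le\<close>)
      finally show ?thesis
        using that dist_triangle[of "?F r" "p 1" "p r"] by (simp add: near_def)
    qed
    have "dist (?F r) (?F s) < e" if "near r" "near s" for r s
      using F_near[OF that(1)] F_near[OF that(2)] by (rule dist_triangle_half_l)
    with ev show "\<exists>P. eventually P (at_left 1) \<and> (\<forall>r s. P r \<and> P s \<longrightarrow> dist (?F r) (?F s) < e)"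
      by (intro exI[of _ near]) simp
  qed
  then show ?thesis
    using complete_uniform[of "UNIV :: complex set"] complete_UNIV
    by (force simp: filterlim_def filtermap_bot_iff)
qed

theorem AE_powser_radial_limit:
  assumes c: "square_summable c"
  shows "AE z in circle_measure. \<exists>l. ((\<lambda>r. powser c (of_real r * z)) \<longlongrightarrow> l) (at_left (1::real))"
proof -
  have "AE z in circle_measure. \<forall>j::nat. \<exists>N. \<forall>r\<in>\<rat> \<inter> {0<..<1}.
      cmod (powser (coeff_tail N c) (of_real r * z)) \<le> inverse (real (Suc j))"
    unfolding AE_all_countable
    by (intro allI AE_powser_coeff_tail_le c countable_Int1 countable_rat) simp_all
  then show ?thesis
    using AE_circle_norm
  proof eventually_elim
    case (elim z)
    show ?case
    proof (rule powser_radial_limit_if_tails_small[OF c elim(2)])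
      fix e :: real assume "0 < e"
      then obtain j where "inverse (real (Suc j)) < e"
        using reals_Archimedean by blast
      then show "\<exists>N. \<forall>r\<in>\<rat> \<inter> {0<..<1}. cmod (powser (coeff_tail N c) (of_real r * z)) < e"
        using elim(1) by (meson le_less_trans)
    qed
  qed
qed

definition taylor_coeff :: "(complex \<Rightarrow> complex) \<Rightarrow> nat \<Rightarrow> complex" where
  "taylor_coeff f n = (deriv ^^ n) f 0 / fact n"

lemma taylor_coeff_sums:
  "f holomorphic_on ball 0 1 \<Longrightarrow> cmod w < 1 \<Longrightarrow> (\<lambda>n. taylor_coeff f n * w ^ n) sums f w"
  using holomorphic_power_series[of f 0 1 w] by (simp add: taylor_coeff_def)

lemma powser_taylor_coeff:
  "f holomorphic_on ball 0 1 \<Longrightarrow> cmod w < 1 \<Longrightarrow> powser (taylor_coeff f) w = f w"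
  unfolding powser_def using taylor_coeff_sums sums_unique by metis

lemma square_summable_taylor_coeff:
  assumes hol: "f holomorphic_on ball 0 1" and bounded: "\<And>z. cmod z < 1 \<Longrightarrow> cmod (f z) \<le> M"
  shows "square_summable (taylor_coeff f)"
proof (rule summableI_nonneg_bounded)
  fix N
  have "(\<Sum>n<N. (cmod (taylor_coeff f n * of_real r ^ n))\<^sup>2) \<le> M\<^sup>2" if r: "r \<in> {0<..<1}" for r
  proof -
    have "summable (\<lambda>n. taylor_coeff f n * of_real ((1 + r) / 2) ^ n)"
      by (rule sums_summable[OF taylor_coeff_sums[OF hol]]) (use r in \<open>simp only: norm_of_real, simp\<close>)
    then have "summable (\<lambda>n. cmod (taylor_coeff f n * of_real r ^ n))"
      by (rule powser_insidea) (use r in \<open>simp only: norm_of_real, simp\<close>)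
    then have sums: "(\<lambda>n. (cmod (taylor_coeff f n * of_real r ^ n))\<^sup>2)
        sums (\<integral>z. (cmod (powser (taylor_coeff f) (of_real r * z)))\<^sup>2 \<partial>circle_measure)"
      unfolding powser_dilation by (rule Parseval_powser)
    have "(\<Sum>n<N. (cmod (taylor_coeff f n * of_real r ^ n))\<^sup>2)
        \<le> (\<integral>z. (cmod (powser (taylor_coeff f) (of_real r * z)))\<^sup>2 \<partial>circle_measure)"
      unfolding sums_unique[OF sums] by (rule sum_le_suminf[OF sums_summable[OF sums]]) auto
    also have "\<dots> \<le> M\<^sup>2"
    proof (rule circle.integral_le_const)
      have le: "(cmod (powser (taylor_coeff f) (of_real r * z)))\<^sup>2 \<le> M\<^sup>2" if "cmod z = 1" for z
        using norm_dilation_less_1[of z r] r that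
        by (intro power_mono) (auto simp: powser_taylor_coeff hol bounded)
      show "integrable circle_measure (\<lambda>z. (cmod (powser (taylor_coeff f) (of_real r * z)))\<^sup>2)"
        by (rule integrable_circle_bounded[where B = "M\<^sup>2"]) (use le in auto)
      show "AE z in circle_measure. (cmod (powser (taylor_coeff f) (of_real r * z)))\<^sup>2 \<le> M\<^sup>2"
        by (intro AE_circleI le)
    qed
    finally show ?thesis .
  qed
  then have "\<forall>\<^sub>F r in at_left (1::real). (\<Sum>n<N. (cmod (taylor_coeff f n * of_real r ^ n))\<^sup>2) \<le> M\<^sup>2"
    using eventually_at_left_real[of 0 1] by (auto elim!: eventually_mono)
  moreover have "((\<lambda>r. \<Sum>n<N. (cmod (taylor_coeff f n * of_real r ^ n))\<^sup>2)
      \<longlongrightarrow> (\<Sum>n<N. (cmod (taylor_coeff f n * of_real 1 ^ n))\<^sup>2)) (at_left (1::real))"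
    by (intro tendsto_intros)
  ultimately show "(\<Sum>n<N. (cmod (taylor_coeff f n))\<^sup>2) \<le> M\<^sup>2"
    using tendsto_upperbound by force
qed simp

section \<open>Approximation by real parts of polynomials\<close>

locale euclidean_finite_borel_measure = finite_measure M for M :: "'a :: euclidean_space measure" +
  assumes sets_eq_borel [measurable_cong]: "sets M = sets borel"
begin

lemma integrable_bcontfun:
  fixes c :: "'a \<Rightarrow> real"
  assumes "c \<in> bcontfun"
  shows "integrable M c"
proof -
  have "continuous_on UNIV c" "bounded (range c)"
    using assms by (auto simp: bcontfun_def)
  then obtain B where "\<And>x. norm (c x) \<le> B"
    by (auto simp: bounded_iff)
  moreover have "c \<in> borel_measurable M"
    using borel_measurable_continuous_onI[OF \<open>continuous_on UNIV c\<close>] by simp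
  ultimately show ?thesis
    by (intro integrable_const_bound[where B = B]) auto
qed

lemma compact_open_approx:
  assumes B: "B \<in> sets borel" and e: "0 < e"
  obtains K U where "compact K" "open U" "K \<subseteq> B" "B \<subseteq> U" "measure M (U - K) < e"
proof -
  have finite: "emeasure M (space M) \<noteq> \<infinity>" "emeasure M B \<noteq> \<infinity>" by simp_all
  have "\<exists>K\<in>{K. K \<subseteq> B \<and> compact K}. emeasure M B < emeasure M K + ennreal (e / 2)"
    by (rule SUP_approx_ennreal[OF _ _ inner_regular[OF sets_eq_borel finite(1) B] finite(2)]) (use e in auto)
  then obtain K where K: "K \<subseteq> B" "compact K" "measure M B < measure M K + e / 2"
    using e by (auto simp: emeasure_eq_measure ennreal_plus[symmetric] ennreal_less_iff simp del: ennreal_plus)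
  have "\<exists>U\<in>{U. B \<subseteq> U \<and> open U}. emeasure M U < emeasure M B + ennreal (e / 2)"
    by (rule INF_approx_ennreal[OF _ outer_regular[OF sets_eq_borel finite(1) B] finite(2)]) (use e in auto)
  then obtain U where U: "B \<subseteq> U" "open U" "measure M U < measure M B + e / 2"
    using e by (auto simp: emeasure_eq_measure ennreal_plus[symmetric] ennreal_less_iff simp del: ennreal_plus)
  have "measure M (U - K) = measure M U - measure M K"
    using K(1,2) U(1,2) by (intro finite_measure_Diff) (auto simp: sets_eq_borel borel_compact)
  then show ?thesis using that K U by auto
qed

lemma L1_approx_bcontfun_indicator:
  assumes B: "B \<in> sets borel" and e: "0 < e"
  shows "\<exists>c\<in>bcontfun. (\<integral>x. \<bar>indicator B x - c x\<bar> \<partial>M) < (e::real)"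
proof -
  obtain K U where KU: "compact K" "open U" "K \<subseteq> B" "B \<subseteq> U" "measure M (U - K) < e"
    using compact_open_approx[OF B e] .
  obtain c :: "'a \<Rightarrow> real" where c: "continuous_on UNIV c" "\<And>x. c x \<in> closed_segment 1 0"
      "\<And>x. x \<in> K \<Longrightarrow> c x = 1" "\<And>x. x \<in> - U \<Longrightarrow> c x = 0"
    using Urysohn_local[of UNIV K "- U" "1::real" 0] KU compact_imp_closed[of K] by auto
  have c01: "0 \<le> c x" "c x \<le> 1" for x
    using c(2)[of x] by (auto simp: closed_segment_eq_real_ivl split: if_splits)
  then have "bounded (range c)"
    unfolding bounded_iff by (intro exI[of _ 1]) auto
  then have bcont: "c \<in> bcontfun"
    using c(1) by (simp add: bcontfun_def)
  have [measurable]: "B \<in> sets M" "U - K \<in> sets M"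
    using B KU by (auto simp: sets_eq_borel borel_compact)
  have "(\<integral>x. \<bar>indicator B x - c x\<bar> \<partial>M) \<le> (\<integral>x. indicator (U - K) x \<partial>M)"
  proof (rule integral_mono)
    show "\<bar>indicator B x - c x\<bar> \<le> indicator (U - K) x" for x
      using c01[of x] c(3,4)[of x] KU(3,4) by (auto split: split_indicator)
  qed (use integrable_bcontfun[OF bcont] in \<open>auto simp: emeasure_eq_measure\<close>)
  also have "\<dots> = measure M (U - K)"
    by (simp add: Int_absorb1 sets.sets_into_space)
  also note \<open>\<dots> < e\<close>
  finally show ?thesis using bcont by blast
qed

lemma integral_abs_diff_triangle:
  fixes f g h :: "'a \<Rightarrow> real"
  assumes "integrable M f" "integrable M g" "integrable M h"
  shows "(\<integral>x. \<bar>f x - h x\<bar> \<partial>M) \<le> (\<integral>x. \<bar>f x - g x\<bar> \<partial>M) + (\<integral>x. \<bar>g x - h x\<bar> \<partial>M)"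
proof -
  have "(\<integral>x. \<bar>f x - h x\<bar> \<partial>M) \<le> (\<integral>x. \<bar>f x - g x\<bar> + \<bar>g x - h x\<bar> \<partial>M)"
    using assms by (intro integral_mono) auto
  then show ?thesis
    using assms by (simp add: Bochner_Integration.integral_add)
qed

lemma integral_abs_diff_tendsto_0:
  fixes f :: "'a \<Rightarrow> real"
  assumes f: "integrable M f" and s: "\<And>i. integrable M (s i)"
    and lim: "\<And>x. x \<in> space M \<Longrightarrow> (\<lambda>i. s i x) \<longlonglongrightarrow> f x"
    and bound: "\<And>i x. x \<in> space M \<Longrightarrow> \<bar>s i x\<bar> \<le> 2 * \<bar>f x\<bar>"
  shows "(\<lambda>i. \<integral>x. \<bar>f x - s i x\<bar> \<partial>M) \<longlonglongrightarrow> 0"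
proof -
  have "(\<lambda>i. \<integral>x. \<bar>f x - s i x\<bar> \<partial>M) \<longlonglongrightarrow> (\<integral>x. 0 \<partial>M)"
  proof (rule integral_dominated_convergence[where w = "\<lambda>x. 3 * \<bar>f x\<bar>"])
    have "(\<lambda>i. \<bar>f x - s i x\<bar>) \<longlonglongrightarrow> \<bar>f x - f x\<bar>" if "x \<in> space M" for x
      by (intro tendsto_intros lim that)
    then show "AE x in M. (\<lambda>i. \<bar>f x - s i x\<bar>) \<longlonglongrightarrow> 0" by simp
    have "\<bar>f x - s i x\<bar> \<le> 3 * \<bar>f x\<bar>" if "x \<in> space M" for x i
      using bound[OF that, of i] by simp
    then show "AE x in M. norm \<bar>f x - s i x\<bar> \<le> 3 * \<bar>f x\<bar>" for i by simp
  qed (use f s in auto)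
  then show ?thesis by simp
qed

lemma L1_approx_bcontfun:
  fixes f :: "'a \<Rightarrow> real"
  assumes "integrable M f" "0 < e"
  shows "\<exists>c\<in>bcontfun. (\<integral>x. \<bar>f x - c x\<bar> \<partial>M) < e"
  using assms
proof (induction f arbitrary: e rule: integrable_induct)
  case (base A a)
  then obtain d where d: "d \<in> bcontfun" "(\<integral>x. \<bar>indicator A x - d x\<bar> \<partial>M) < e / (\<bar>a\<bar> + 1)"
    using L1_approx_bcontfun_indicator[of A "e / (\<bar>a\<bar> + 1)"] by (auto simp: sets_eq_borel)
  have "(\<integral>x. \<bar>indicator A x *\<^sub>R a - a * d x\<bar> \<partial>M) = \<bar>a\<bar> * (\<integral>x. \<bar>indicator A x - d x\<bar> \<partial>M)"
    by (subst integral_mult_right_zero[symmetric], rule Bochner_Integration.integral_cong)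
      (auto simp: abs_mult[symmetric] algebra_simps)
  also have "\<dots> \<le> (\<bar>a\<bar> + 1) * (\<integral>x. \<bar>indicator A x - d x\<bar> \<partial>M)"
    by (intro mult_right_mono) auto
  also have "\<dots> < e"
    using d(2) by (simp add: pos_less_divide_eq mult.commute)
  finally show ?case
    using scaleR_cont[OF d(1), of a] by auto
next
  case (add f g)
  obtain c d where c: "c \<in> bcontfun" "(\<integral>x. \<bar>f x - c x\<bar> \<partial>M) < e / 2"
    and d: "d \<in> bcontfun" "(\<integral>x. \<bar>g x - d x\<bar> \<partial>M) < e / 2"
    using add.IH[of "e / 2"] add.prems by auto
  note integrable = add.hyps integrable_bcontfun[OF c(1)] integrable_bcontfun[OF d(1)]
  have "(\<integral>x. \<bar>(f x + g x) - (c x + d x)\<bar> \<partial>M) \<le> (\<integral>x. \<bar>f x - c x\<bar> + \<bar>g x - d x\<bar> \<partial>M)"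
    using integrable by (intro integral_mono) auto
  also have "\<dots> = (\<integral>x. \<bar>f x - c x\<bar> \<partial>M) + (\<integral>x. \<bar>g x - d x\<bar> \<partial>M)"
    using integrable by (intro Bochner_Integration.integral_add) auto
  also have "\<dots> < e" using c(2) d(2) by simp
  finally show ?case
    using plus_cont[OF c(1) d(1)] by auto
next
  case (lim f s)
  then have "(\<lambda>i. \<integral>x. \<bar>f x - s i x\<bar> \<partial>M) \<longlonglongrightarrow> 0"
    by (intro integral_abs_diff_tendsto_0) auto
  then have "\<forall>\<^sub>F i in sequentially. (\<integral>x. \<bar>f x - s i x\<bar> \<partial>M) < e / 2"
    using lim.prems by (intro order_tendstoD(2)[of _ 0]) auto
  then obtain i where i: "(\<integral>x. \<bar>f x - s i x\<bar> \<partial>M) < e / 2"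
    unfolding eventually_sequentially by blast
  obtain c where c: "c \<in> bcontfun" "(\<integral>x. \<bar>s i x - c x\<bar> \<partial>M) < e / 2"
    using lim.IH[of "e / 2" i] lim.prems by auto
  then have "(\<integral>x. \<bar>f x - c x\<bar> \<partial>M) < e"
    using integral_abs_diff_triangle[of f "s i" c] lim.hyps integrable_bcontfun i by fastforce
  with c(1) show ?case by blast
qed

end

definition harmonic_poly :: "(complex \<Rightarrow> real) \<Rightarrow> bool" where
  "harmonic_poly p \<longleftrightarrow> (\<exists>Q. \<forall>z. cmod z = 1 \<longrightarrow> p z = Re (poly Q z))"

lemma harmonic_poly_const: "harmonic_poly (\<lambda>_. a)"
  unfolding harmonic_poly_def by (intro exI[of _ "[:of_real a:]"]) simp

lemma harmonic_poly_add:
  assumes "harmonic_poly p" "harmonic_poly q"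
  shows "harmonic_poly (\<lambda>z. p z + q z)"
proof -
  from assms obtain P Q where "\<forall>z. cmod z = 1 \<longrightarrow> p z = Re (poly P z)" "\<forall>z. cmod z = 1 \<longrightarrow> q z = Re (poly Q z)"
    unfolding harmonic_poly_def by blast
  then show ?thesis
    unfolding harmonic_poly_def by (intro exI[of _ "P + Q"]) simp
qed

lemma harmonic_poly_sum:
  "finite I \<Longrightarrow> (\<And>i. i \<in> I \<Longrightarrow> harmonic_poly (p i)) \<Longrightarrow> harmonic_poly (\<lambda>z. \<Sum>i\<in>I. p i z)"
  by (induction I rule: finite_induct) (auto intro: harmonic_poly_add harmonic_poly_const)

lemma harmonic_poly_monomial_mult: "harmonic_poly (\<lambda>z. Re (a * z ^ j) * Re (b * z ^ k))"
proof -
  have le: "harmonic_poly (\<lambda>z. Re (a * z ^ j) * Re (b * z ^ k))" if "k \<le> j" for a b j k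
  proof -
    have "Re (a * z ^ j) * Re (b * z ^ k)
        = Re (poly (monom (a * b / 2) (j + k) + monom (a * cnj b / 2) (j - k)) z)"
      if "cmod z = 1" for z
    proof -
      have Re_mult_Re: "Re u * Re v = Re ((u * v + u * cnj v) / 2)" for u v :: complex by simp
      have "(a * z ^ j) * cnj (b * z ^ k) = a * cnj b * (z ^ j * cnj (z ^ k))"
        by (simp add: mult_ac)
      also have "\<dots> = a * cnj b * z ^ (j - k)"
        by (simp only: circle_power_mult_cnj_power[OF that \<open>k \<le> j\<close>])
      finally have product: "(a * z ^ j) * cnj (b * z ^ k) = a * cnj b * z ^ (j - k)" .
      have "((a * z ^ j) * (b * z ^ k) + (a * z ^ j) * cnj (b * z ^ k)) / 2
          = poly (monom (a * b / 2) (j + k) + monom (a * cnj b / 2) (j - k)) z"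
        unfolding product by (simp add: poly_monom power_add add_divide_distrib)
      then show ?thesis by (simp only: Re_mult_Re)
    qed
    then show ?thesis unfolding harmonic_poly_def by blast
  qed
  show ?thesis
    using le[of k j a b] le[of j k b a] by (cases "k \<le> j") (auto simp: mult.commute)
qed

lemma harmonic_poly_mult:
  assumes "harmonic_poly p" "harmonic_poly q"
  shows "harmonic_poly (\<lambda>z. p z * q z)"
proof -
  from assms obtain P Q where P: "\<And>z. cmod z = 1 \<Longrightarrow> p z = Re (poly P z)"
    and Q: "\<And>z. cmod z = 1 \<Longrightarrow> q z = Re (poly Q z)"
    unfolding harmonic_poly_def by blast
  have "harmonic_poly (\<lambda>z. \<Sum>i\<le>degree P. \<Sum>j\<le>degree Q. Re (coeff P i * z ^ i) * Re (coeff Q j * z ^ j))"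
    by (intro harmonic_poly_sum harmonic_poly_monomial_mult) auto
  moreover have "(\<Sum>i\<le>degree P. \<Sum>j\<le>degree Q. Re (coeff P i * z ^ i) * Re (coeff Q j * z ^ j)) = p z * q z"
    if "cmod z = 1" for z
    unfolding P[OF that] Q[OF that] poly_altdef Re_sum sum_product ..
  ultimately show ?thesis
    unfolding harmonic_poly_def by auto
qed

lemma harmonic_poly_real_polynomial_function:
  assumes "real_polynomial_function p"
  shows "harmonic_poly p"
  using assms
proof (induction rule: real_polynomial_function.induct)
  case (linear f)
  interpret bounded_linear f by fact
  have "f z = Re (poly [:0, Complex (f 1) (- f \<i>):] z)" for z
  proof -
    have "z = Re z *\<^sub>R 1 + Im z *\<^sub>R \<i>" by (simp add: complex_eq_iff)
    then have "f z = Re z * f 1 + Im z * f \<i>" by (metis add scaleR real_scaleR_def)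
    then show ?thesis by simp
  qed
  then show ?case unfolding harmonic_poly_def by blast
qed (auto intro: harmonic_poly_const harmonic_poly_add harmonic_poly_mult)

lemma continuous_approx_Re_poly:
  fixes c :: "complex \<Rightarrow> real"
  assumes "continuous_on UNIV c" "0 < e"
  obtains Q where "\<And>z. cmod z = 1 \<Longrightarrow> \<bar>c z - Re (poly Q z)\<bar> < e"
proof -
  obtain p where p: "real_polynomial_function p" "\<And>z. z \<in> sphere 0 1 \<Longrightarrow> \<bar>c z - p z\<bar> < e"
    using Stone_Weierstrass_real_polynomial_function[of "sphere 0 1" c e] assms
    by (metis compact_sphere continuous_on_subset subset_UNIV)
  obtain Q where "\<And>z. cmod z = 1 \<Longrightarrow> p z = Re (poly Q z)"
    using harmonic_poly_real_polynomial_function[OF p(1)] unfolding harmonic_poly_def by blast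
  with p(2) show ?thesis
    by (intro that[of Q]) (metis mem_sphere_0)
qed

lemma measurable_poly [measurable]: "(\<lambda>z. poly (Q :: complex poly) z) \<in> borel_measurable borel"
  by (intro borel_measurable_continuous_onI continuous_intros)

lemma integrable_poly: "integrable circle_measure (poly Q)"
  by (rule integrable_circle_continuous) (auto intro!: continuous_intros)

lemma integral_Re_poly: "(\<integral>z. Re (poly Q z) \<partial>circle_measure) = Re (poly Q 0)"
proof -
  have "integral\<^sup>L circle_measure (poly Q) = poly Q 0"
    by (rule mean_value_circle_measure) (auto intro!: continuous_intros holomorphic_intros)
  then show ?thesis
    using integral_Re[OF integrable_poly[of Q]] by simp
qed

lemma L1_approx_Re_poly:
  fixes f :: "complex \<Rightarrow> real"
  assumes M: "euclidean_finite_borel_measure M" and circle: "AE z in M. cmod z = 1"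
    and f: "integrable M f" "\<And>z. 0 \<le> f z" and e: "0 < e"
  obtains Q where "\<And>z. cmod z = 1 \<Longrightarrow> 0 \<le> Re (poly Q z)" "Im (poly Q 0) = 0"
    "(\<integral>z. \<bar>f z - Re (poly Q z)\<bar> \<partial>M) \<le> e"
proof -
  interpret euclidean_finite_borel_measure M by fact
  obtain c where c: "c \<in> bcontfun" "(\<integral>z. \<bar>f z - c z\<bar> \<partial>M) < e / 3"
    using L1_approx_bcontfun[OF f(1), of "e / 3"] e by auto
  define d where "d = e / (3 * (measure M (space M) + 1))"
  have d: "0 < d" "2 * d * measure M (space M) \<le> 2 * e / 3"
    using e by (auto simp: d_def field_simps add_pos_nonneg)
  obtain Q0 where Q0: "\<And>z. cmod z = 1 \<Longrightarrow> \<bar>max (c z) 0 - Re (poly Q0 z)\<bar> < d"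
    by (rule continuous_approx_Re_poly[of "\<lambda>z. max (c z) 0" d])
      (use c(1) d in \<open>auto intro!: continuous_intros simp: bcontfun_def\<close>)
  define Q where "Q = Q0 + [:of_real d - \<i> * of_real (Im (poly Q0 0)):]"
  have Q: "Re (poly Q z) = Re (poly Q0 z) + d" for z by (simp add: Q_def)
  have integrable: "integrable M (\<lambda>z. \<bar>f z - c z\<bar> + 2 * d)"
    using f(1) integrable_bcontfun[OF c(1)] by simp
  have bound: "AE z in M. \<bar>f z - Re (poly Q z)\<bar> \<le> \<bar>f z - c z\<bar> + 2 * d"
    using circle
  proof eventually_elim
    case (elim z)
    have "\<bar>f z - max (c z) 0\<bar> \<le> \<bar>f z - c z\<bar>"
      using f(2)[of z] by (auto simp: max_def)
    with Q0[OF elim] show ?case unfolding Q by linarith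
  qed
  have "(\<integral>z. \<bar>f z - Re (poly Q z)\<bar> \<partial>M) \<le> e"
  proof -
    have "(\<integral>z. \<bar>f z - Re (poly Q z)\<bar> \<partial>M) \<le> (\<integral>z. \<bar>f z - c z\<bar> + 2 * d \<partial>M)"
      using d(1) by (intro integral_mono_AE' integrable bound) auto
    also have "\<dots> = (\<integral>z. \<bar>f z - c z\<bar> \<partial>M) + 2 * d * measure M (space M)"
      using f(1) integrable_bcontfun[OF c(1)] by simp
    also have "\<dots> \<le> e" using c(2) d(2) by simp
    finally show ?thesis .
  qed
  moreover have "0 \<le> Re (poly Q z)" if "cmod z = 1" for z
    using Q0[OF that] max.cobounded2[of 0 "c z"] unfolding Q by linarith
  moreover have "Im (poly Q 0) = 0" by (simp add: Q_def)
  ultimately show ?thesis using that by blast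
qed

lemma euclidean_finite_borel_measure_circle: "euclidean_finite_borel_measure circle_measure"
  by unfold_locales simp

lemma euclidean_finite_borel_measure_density:
  fixes u :: "complex \<Rightarrow> real"
  assumes "integrable circle_measure u"
  shows "euclidean_finite_borel_measure (density circle_measure (\<lambda>z. ennreal \<bar>u z\<bar>))"
proof -
  have "emeasure (density circle_measure (\<lambda>z. ennreal \<bar>u z\<bar>)) UNIV < \<infinity>"
    using assms by (subst emeasure_density) (auto simp: integrable_iff_bounded)
  then have "finite_measure (density circle_measure (\<lambda>z. ennreal \<bar>u z\<bar>))"
    by (intro finite_measureI) simp
  then show ?thesis
    by (simp add: euclidean_finite_borel_measure_def euclidean_finite_borel_measure_axioms_def)
qed

lemma integrable_mult_circle_continuous:
  fixes u b :: "complex \<Rightarrow> 'a :: {real_normed_algebra, banach, second_countable_topology}"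
  assumes u: "integrable circle_measure u"
    and [measurable]: "b \<in> borel_measurable borel" and b: "continuous_on (sphere 0 1) b"
  shows "integrable circle_measure (\<lambda>z. u z * b z)"
proof -
  obtain B where B: "\<And>z. cmod z = 1 \<Longrightarrow> norm (b z) \<le> B"
    using bounded_on_circle[OF b] by blast
  have [measurable]: "u \<in> borel_measurable borel" using u by auto
  show ?thesis
  proof (rule Bochner_Integration.integrable_bound)
    show "integrable circle_measure (\<lambda>z. B *\<^sub>R norm (u z))" using u by auto
    show "AE z in circle_measure. norm (u z * b z) \<le> norm (B *\<^sub>R norm (u z))"
    proof (rule AE_circleI)
      fix z :: complex assume "cmod z = 1"
      have "norm (u z * b z) \<le> norm (u z) * norm (b z)"
        by (rule norm_mult_ineq)
      also have "\<dots> \<le> norm (u z) * B"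
        using \<open>cmod z = 1\<close> by (intro mult_left_mono B) auto
      finally show "norm (u z * b z) \<le> norm (B *\<^sub>R norm (u z))"
        by (simp add: mult.commute)
    qed
  qed measurable
qed

lemma integral_mult_Re_poly_eq_0:
  fixes u :: "complex \<Rightarrow> real"
  assumes u: "integrable circle_measure u"
    and moments: "\<And>n. (\<integral>z. of_real (u z) * z ^ n \<partial>circle_measure) = 0"
  shows "(\<integral>z. u z * Re (poly Q z) \<partial>circle_measure) = 0"
proof -
  have [measurable]: "u \<in> borel_measurable borel" using u by auto
  have "integrable circle_measure (\<lambda>z. of_real (u z) * z ^ n)" for n
    by (rule integrable_mult_circle_continuous) (use u in \<open>auto intro!: continuous_intros\<close>)
  then have integrable: "integrable circle_measure (\<lambda>z. coeff Q n * (of_real (u z) * z ^ n))" for n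
    by simp
  have poly: "of_real (u z) * poly Q z = (\<Sum>n\<le>degree Q. coeff Q n * (of_real (u z) * z ^ n))" for z
    by (simp add: poly_altdef sum_distrib_left mult_ac)
  have "(\<integral>z. u z * Re (poly Q z) \<partial>circle_measure) = (\<integral>z. Re (of_real (u z) * poly Q z) \<partial>circle_measure)"
    by simp
  also have "\<dots> = Re (\<integral>z. of_real (u z) * poly Q z \<partial>circle_measure)"
    unfolding poly using integrable by (intro integral_Re) auto
  also have "(\<integral>z. of_real (u z) * poly Q z \<partial>circle_measure) = 0"
    unfolding poly using integrable moments by (simp add: Bochner_Integration.integral_sum)
  finally show ?thesis by simp
qed

lemma integral_abs_eq_integral_mult_sgn_minus_Re_poly:
  fixes u :: "complex \<Rightarrow> real"
  assumes u: "integrable circle_measure u"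
    and moments: "\<And>n. (\<integral>z. of_real (u z) * z ^ n \<partial>circle_measure) = 0"
  shows "(\<integral>z. \<bar>u z\<bar> \<partial>circle_measure) = (\<integral>z. u z * ((1 + sgn (u z)) - Re (poly Q z)) \<partial>circle_measure)"
proof -
  let ?M = circle_measure
  have u_Q: "integrable ?M (\<lambda>z. u z * Re (poly Q z))"
    by (rule integrable_mult_circle_continuous[OF u]) (auto intro!: continuous_intros)
  have "(\<integral>z. u z * ((1 + sgn (u z)) - Re (poly Q z)) \<partial>?M)
      = (\<integral>z. (u z + \<bar>u z\<bar>) - u z * Re (poly Q z) \<partial>?M)"
    by (simp add: right_diff_distrib distrib_left abs_sgn)
  also have "\<dots> = (\<integral>z. u z \<partial>?M) + (\<integral>z. \<bar>u z\<bar> \<partial>?M) - (\<integral>z. u z * Re (poly Q z) \<partial>?M)"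
    using u u_Q by simp
  also have "\<dots> = (\<integral>z. \<bar>u z\<bar> \<partial>?M)"
    using moments[of 0] integral_mult_Re_poly_eq_0[OF u moments] by simp
  finally show ?thesis ..
qed

text \<open>The function \<open>1 + sgn u\<close> is approximated by real parts of polynomials, to which \<open>u\<close> is
  orthogonal, in the \<open>L\<^sup>1\<close> norm of the measure with density \<open>\<bar>u\<bar>\<close>.\<close>

lemma AE_zero_if_moments_zero:
  fixes u :: "complex \<Rightarrow> real"
  assumes u: "integrable circle_measure u"
    and moments: "\<And>n. (\<integral>z. of_real (u z) * z ^ n \<partial>circle_measure) = 0"
  shows "AE z in circle_measure. u z = 0"
proof -
  let ?M = circle_measure
  define N where "N = density ?M (\<lambda>z. ennreal \<bar>u z\<bar>)"
  have [measurable]: "u \<in> borel_measurable borel" using u by auto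
  interpret N: euclidean_finite_borel_measure N
    unfolding N_def by (rule euclidean_finite_borel_measure_density[OF u])
  have circle: "AE z in N. cmod z = 1"
    unfolding N_def by (subst AE_density) (auto intro: AE_circleI)
  have sgn: "integrable N (\<lambda>z. 1 + sgn (u z))"
    by (rule N.integrable_const_bound[where B = 2]) (auto simp: N_def sgn_if)
  have sgn_ge: "0 \<le> 1 + sgn (u z)" for z
    by (simp add: sgn_if)
  have "(\<integral>z. \<bar>u z\<bar> \<partial>?M) \<le> e" if e: "0 < e" for e
  proof -
    obtain Q where Q: "(\<integral>z. \<bar>(1 + sgn (u z)) - Re (poly Q z)\<bar> \<partial>N) \<le> e"
      using L1_approx_Re_poly[OF N.euclidean_finite_borel_measure_axioms circle sgn sgn_ge e] by metis
    have "(\<integral>z. \<bar>u z\<bar> \<partial>?M) = (\<integral>z. u z * ((1 + sgn (u z)) - Re (poly Q z)) \<partial>?M)"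
      by (rule integral_abs_eq_integral_mult_sgn_minus_Re_poly[OF u moments])
    also have "\<dots> \<le> (\<integral>z. \<bar>u z * ((1 + sgn (u z)) - Re (poly Q z))\<bar> \<partial>?M)"
      by (rule integral_abs_bound[THEN order_trans[OF abs_ge_self]])
    also have "\<dots> = (\<integral>z. \<bar>(1 + sgn (u z)) - Re (poly Q z)\<bar> \<partial>N)"
      unfolding N_def by (subst integral_density) (auto simp: abs_mult)
    finally show ?thesis using Q by simp
  qed
  then have "(\<integral>z. \<bar>u z\<bar> \<partial>?M) \<le> 0"
    by (rule field_le_epsilon[of _ 0, simplified])
  then have "(\<integral>z. \<bar>u z\<bar> \<partial>?M) = 0"
    by (intro antisym) auto
  then show ?thesis
    using u by (subst (asm) integral_nonneg_eq_0_iff_AE) auto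
qed

section \<open>The spaces L2 and H2 of the circle\<close>

lemma L2T_iff:
  "f \<in> L2T \<longleftrightarrow> f \<in> borel_measurable borel \<and> integrable circle_measure (\<lambda>z. (cmod (f z))\<^sup>2)"
  unfolding L2T_def by auto

lemma L2T_measurable: "f \<in> L2T \<Longrightarrow> f \<in> borel_measurable borel"
  by (simp add: L2T_iff)

lemma L2T_integrable_norm_mult:
  assumes "f \<in> L2T" "h \<in> L2T"
  shows "integrable circle_measure (\<lambda>z. cmod (f z) * cmod (h z))"
proof (rule Bochner_Integration.integrable_bound)
  show "integrable circle_measure (\<lambda>z. (cmod (f z))\<^sup>2 + (cmod (h z))\<^sup>2)"
    using assms by (auto simp: L2T_iff)
  have "cmod (f z) * cmod (h z) \<le> (cmod (f z))\<^sup>2 + (cmod (h z))\<^sup>2" for z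
  proof -
    have "0 \<le> cmod (f z) * cmod (h z)" by simp
    then show ?thesis
      using sum_squares_bound[of "cmod (f z)" "cmod (h z)"] by linarith
  qed
  then show "AE z in circle_measure. norm (cmod (f z) * cmod (h z)) \<le> norm ((cmod (f z))\<^sup>2 + (cmod (h z))\<^sup>2)"
    by simp
qed (use assms in \<open>auto dest!: L2T_measurable\<close>)

lemma L2T_integrable_mult_cnj:
  assumes "f \<in> L2T" "h \<in> L2T"
  shows "integrable circle_measure (\<lambda>z. f z * cnj (h z))"
proof (rule Bochner_Integration.integrable_bound[OF L2T_integrable_norm_mult[OF assms]])
  have [measurable]: "f \<in> borel_measurable borel" "h \<in> borel_measurable borel"
    using assms by (auto intro: L2T_measurable)
  show "(\<lambda>z. f z * cnj (h z)) \<in> borel_measurable circle_measure" by measurable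
qed (simp add: norm_mult)

lemma L2T_bounded_mult:
  assumes f: "f \<in> L2T" and [measurable]: "b \<in> borel_measurable borel"
    and b: "AE z in circle_measure. cmod (b z) \<le> B"
  shows "(\<lambda>z. b z * f z) \<in> L2T"
proof -
  have [measurable]: "f \<in> borel_measurable borel" using f by (rule L2T_measurable)
  have "integrable circle_measure (\<lambda>z. (cmod (b z * f z))\<^sup>2)"
  proof (rule Bochner_Integration.integrable_bound)
    show "integrable circle_measure (\<lambda>z. B\<^sup>2 * (cmod (f z))\<^sup>2)"
      using f by (simp add: L2T_iff)
    show "AE z in circle_measure. norm ((cmod (b z * f z))\<^sup>2) \<le> norm (B\<^sup>2 * (cmod (f z))\<^sup>2)"
      using b
    proof eventually_elim
      case (elim z)
      then have "(cmod (b z))\<^sup>2 \<le> B\<^sup>2" by (intro power_mono) auto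
      then show ?case by (simp add: norm_mult power_mult_distrib mult_right_mono)
    qed
  qed measurable
  then show ?thesis by (simp add: L2T_iff)
qed

lemma one_in_L2T: "(\<lambda>_. 1) \<in> L2T"
  by (simp add: L2T_iff)

lemma L2T_bounded:
  "b \<in> borel_measurable borel \<Longrightarrow> AE z in circle_measure. cmod (b z) \<le> B \<Longrightarrow> b \<in> L2T"
  using L2T_bounded_mult[OF one_in_L2T] by simp

lemma L2T_integrable: "f \<in> L2T \<Longrightarrow> integrable circle_measure f"
  using L2T_integrable_mult_cnj[OF _ one_in_L2T] by simp

lemma L2T_cmult: "f \<in> L2T \<Longrightarrow> (\<lambda>z. c * f z) \<in> L2T"
  by (rule L2T_bounded_mult[where B = "cmod c"]) auto

lemma L2T_diff:
  assumes "f \<in> L2T" "h \<in> L2T"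
  shows "(\<lambda>z. f z - h z) \<in> L2T"
proof -
  have [measurable]: "f \<in> borel_measurable borel" "h \<in> borel_measurable borel"
    using assms by (auto intro: L2T_measurable)
  have "integrable circle_measure (\<lambda>z. (cmod (f z - h z))\<^sup>2)"
  proof (rule Bochner_Integration.integrable_bound)
    show "integrable circle_measure (\<lambda>z. 2 * (cmod (f z))\<^sup>2 + 2 * (cmod (h z))\<^sup>2)"
      using assms by (simp add: L2T_iff)
    have "(cmod (f z - h z))\<^sup>2 \<le> 2 * (cmod (f z))\<^sup>2 + 2 * (cmod (h z))\<^sup>2" for z
    proof -
      have "(cmod (f z - h z))\<^sup>2 \<le> (cmod (f z) + cmod (h z))\<^sup>2"
        by (intro power_mono norm_triangle_ineq4) simp
      then show ?thesis
        using sum_squares_bound[of "cmod (f z)" "cmod (h z)"] by (simp add: power2_sum)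
    qed
    then show "AE z in circle_measure.
        norm ((cmod (f z - h z))\<^sup>2) \<le> norm (2 * (cmod (f z))\<^sup>2 + 2 * (cmod (h z))\<^sup>2)"
      by simp
  qed measurable
  then show ?thesis by (simp add: L2T_iff)
qed

lemma l2_inner_add: "f \<in> L2T \<Longrightarrow> h \<in> L2T \<Longrightarrow> k \<in> L2T \<Longrightarrow>
    l2_inner (\<lambda>z. f z + h z) k = l2_inner f k + l2_inner h k"
  unfolding l2_inner_def by (simp add: distrib_right L2T_integrable_mult_cnj)

lemma l2_inner_diff: "f \<in> L2T \<Longrightarrow> h \<in> L2T \<Longrightarrow> k \<in> L2T \<Longrightarrow>
    l2_inner (\<lambda>z. f z - h z) k = l2_inner f k - l2_inner h k"
  unfolding l2_inner_def by (simp add: left_diff_distrib L2T_integrable_mult_cnj)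

lemma l2_inner_cmult: "l2_inner (\<lambda>z. c * f z) k = c * l2_inner f k"
  unfolding l2_inner_def by (simp add: mult.assoc)

lemma l2_inner_commute: "l2_inner f h = cnj (l2_inner h f)"
  unfolding l2_inner_def Bochner_Integration.integral_cnj[symmetric] by (simp add: mult.commute)

lemma l2_norm_nonneg [simp]: "0 \<le> l2_norm f"
  unfolding l2_norm_def by simp

lemma l2_norm_square: "(l2_norm f)\<^sup>2 = (\<integral>z. (cmod (f z))\<^sup>2 \<partial>circle_measure)"
  unfolding l2_norm_def by simp

lemma l2_norm_cmult: "l2_norm (\<lambda>z. c * f z) = cmod c * l2_norm f"
  unfolding l2_norm_def by (simp add: norm_mult power_mult_distrib real_sqrt_mult)

lemma l2_norm_mult_power:
  assumes [measurable]: "f \<in> borel_measurable borel"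
  shows "l2_norm (\<lambda>z. f z * z ^ j) = l2_norm f"
proof -
  have "(\<integral>z. (cmod (f z * z ^ j))\<^sup>2 \<partial>circle_measure) = (\<integral>z. (cmod (f z))\<^sup>2 \<partial>circle_measure)"
    by (rule integral_circle_cong) (auto simp: norm_mult norm_power)
  then show ?thesis by (simp add: l2_norm_def)
qed

lemma l2_inner_self: "l2_inner f f = of_real ((l2_norm f)\<^sup>2)"
  unfolding l2_inner_def l2_norm_square complex_norm_square[symmetric]
  by (simp only: integral_complex_of_real)

lemma l2_Cauchy_Schwarz:
  assumes f: "f \<in> L2T" and h: "h \<in> L2T"
  shows "cmod (l2_inner f h) \<le> l2_norm f * l2_norm h"
proof -
  have [measurable]: "f \<in> borel_measurable borel" "h \<in> borel_measurable borel"
    using assms by (auto intro: L2T_measurable)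
  have square: "(\<integral>\<^sup>+z. ennreal (cmod (k z)) ^ 2 \<partial>circle_measure) = ennreal ((l2_norm k)\<^sup>2)" if "k \<in> L2T" for k
    using that unfolding l2_norm_square L2T_iff
    by (subst nn_integral_eq_integral[symmetric]) (auto simp: ennreal_power)
  have "cmod (l2_inner f h) \<le> (\<integral>z. cmod (f z) * cmod (h z) \<partial>circle_measure)"
    unfolding l2_inner_def by (rule order_trans[OF integral_norm_bound]) (simp add: norm_mult)
  also have "\<dots> \<le> l2_norm f * l2_norm h"
  proof (rule power2_le_imp_le)
    have "ennreal ((\<integral>z. cmod (f z) * cmod (h z) \<partial>circle_measure)\<^sup>2)
        = (\<integral>\<^sup>+z. ennreal (cmod (f z)) * ennreal (cmod (h z)) \<partial>circle_measure)\<^sup>2"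
      using nn_integral_eq_integral[OF L2T_integrable_norm_mult[OF f h]]
      by (simp add: ennreal_power[symmetric] ennreal_mult)
    also have "\<dots> \<le> ennreal ((l2_norm f)\<^sup>2) * ennreal ((l2_norm h)\<^sup>2)"
      unfolding square[OF f, symmetric] square[OF h, symmetric] by (rule Cauchy_Schwarz_nn_integral) auto
    also have "\<dots> = ennreal ((l2_norm f * l2_norm h)\<^sup>2)"
      by (simp add: ennreal_mult power_mult_distrib)
    finally show "(\<integral>z. cmod (f z) * cmod (h z) \<partial>circle_measure)\<^sup>2 \<le> (l2_norm f * l2_norm h)\<^sup>2"
      by (simp add: ennreal_le_iff)
  qed simp
  finally show ?thesis .
qed

lemma l2_inner_cong_AE:
  assumes "AE z in circle_measure. f z = f' z" "AE z in circle_measure. h z = h' z"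
    and [measurable]: "f \<in> borel_measurable borel" "f' \<in> borel_measurable borel"
      "h \<in> borel_measurable borel" "h' \<in> borel_measurable borel"
  shows "l2_inner f h = l2_inner f' h'"
  unfolding l2_inner_def
proof (rule integral_cong_AE)
  show "AE z in circle_measure. f z * cnj (h z) = f' z * cnj (h' z)"
    using assms(1,2) by eventually_elim simp
qed measurable

lemma H2_L2T: "f \<in> H2 \<Longrightarrow> f \<in> L2T"
  unfolding H2_def by simp

lemma H2_measurable: "f \<in> H2 \<Longrightarrow> f \<in> borel_measurable borel"
  by (intro L2T_measurable H2_L2T)

lemma fourier_coeff_minus:
  assumes [measurable]: "f \<in> borel_measurable borel"
  shows "fourier_coeff f (- int n) = (\<integral>z. f z * z ^ n \<partial>circle_measure)"
  unfolding fourier_coeff_def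
proof (rule integral_circle_cong)
  fix z :: complex assume "cmod z = 1"
  then have "z * cnj z = 1" by (simp add: complex_norm_square[symmetric])
  then have "inverse (cnj z) = z" by (metis inverse_unique mult.commute)
  then show "f z * cnj (z powi (- int n)) = f z * z ^ n"
    by (simp add: power_int_minus power_inverse[symmetric])
qed (simp_all add: power_int_minus)

lemma H2_iff_moments:
  "f \<in> H2 \<longleftrightarrow> f \<in> L2T \<and> (\<forall>n\<ge>1. (\<integral>z. f z * z ^ n \<partial>circle_measure) = 0)"
proof -
  have "(\<forall>k<0. fourier_coeff f k = 0) \<longleftrightarrow> (\<forall>n\<ge>1. fourier_coeff f (- int n) = 0)"
  proof (intro iffI allI impI)
    fix k :: int assume *: "\<forall>n\<ge>1. fourier_coeff f (- int n) = 0" and "k < 0"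
    then have "k = - int (nat (- k))" "nat (- k) \<ge> 1" by simp_all
    with * show "fourier_coeff f k = 0" by metis
  qed simp
  then show ?thesis
    unfolding H2_def by (auto simp: fourier_coeff_minus L2T_measurable)
qed



lemma one_in_H2: "(\<lambda>_. 1) \<in> H2"
  by (simp add: H2_iff_moments one_in_L2T integral_power_circle)

lemma H2_cong_AE:
  assumes f: "f \<in> H2" and [measurable]: "h \<in> borel_measurable borel"
    and eq: "AE z in circle_measure. f z = h z"
  shows "h \<in> H2"
proof -
  have [measurable]: "f \<in> borel_measurable borel" using f by (rule H2_measurable)
  have "integrable circle_measure (\<lambda>z. (cmod (h z))\<^sup>2)"
    by (rule integrable_cong_AE_imp[of _ "\<lambda>z. (cmod (f z))\<^sup>2"])
      (use H2_L2T[OF f] eq in \<open>auto simp: L2T_iff elim!: eventually_mono\<close>)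
  moreover have "(\<integral>z. h z * z ^ n \<partial>circle_measure) = (\<integral>z. f z * z ^ n \<partial>circle_measure)" for n
    by (rule integral_cong_AE) (use eq in \<open>auto elim!: eventually_mono\<close>)
  ultimately show ?thesis
    using f by (simp add: H2_iff_moments L2T_iff)
qed

lemma AE_Re_zero_if_moments_zero:
  assumes x: "integrable circle_measure x"
    and moments: "\<And>n. (\<integral>z. x z * z ^ n \<partial>circle_measure) = 0"
    and cnj_moments: "\<And>n. (\<integral>z. x z * cnj (z ^ n) \<partial>circle_measure) = 0"
  shows "AE z in circle_measure. Re (x z) = 0"
proof (rule AE_zero_if_moments_zero)
  fix n
  have [measurable]: "x \<in> borel_measurable borel" using x by auto
  have int: "integrable circle_measure (\<lambda>z. x z * z ^ n)"
    "integrable circle_measure (\<lambda>z. cnj (x z) * z ^ n)"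
    by (rule integrable_mult_circle_continuous; use x in \<open>auto intro!: continuous_intros\<close>)+
  have "of_real (Re w) = (w + cnj w) / 2" for w
    by (simp add: complex_add_cnj)
  then have "(\<integral>z. of_real (Re (x z)) * z ^ n \<partial>circle_measure)
      = (\<integral>z. (x z * z ^ n + cnj (x z) * z ^ n) / 2 \<partial>circle_measure)"
    by (simp only: distrib_right times_divide_eq_left)
  also have "\<dots> = ((\<integral>z. x z * z ^ n \<partial>circle_measure) + (\<integral>z. cnj (x z) * z ^ n \<partial>circle_measure)) / 2"
    using int by simp
  also have "(\<integral>z. cnj (x z) * z ^ n \<partial>circle_measure) = cnj (\<integral>z. x z * cnj (z ^ n) \<partial>circle_measure)"
    unfolding Bochner_Integration.integral_cnj[symmetric] by simp
  finally show "(\<integral>z. of_real (Re (x z)) * z ^ n \<partial>circle_measure) = 0"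
    by (simp only: moments cnj_moments) simp
qed (use x in auto)

lemma H2_nonzero_coefficient:
  assumes x: "x \<in> H2" and nonzero: "l2_norm x \<noteq> 0"
  obtains j where "l2_inner (\<lambda>z. z ^ j) x \<noteq> 0"
proof (rule ccontr)
  assume "\<not> thesis"
  then have "l2_inner (\<lambda>z. z ^ n) x = 0" for n using that by blast
  then have cnj_moments: "(\<integral>z. x z * cnj (z ^ n) \<partial>circle_measure) = 0" for n
    using l2_inner_commute[of x "\<lambda>z. z ^ n"] by (simp add: l2_inner_def)
  then have moments: "(\<integral>z. x z * z ^ n \<partial>circle_measure) = 0" for n
    using x cnj_moments[of 0] unfolding H2_iff_moments by (cases "n = 0") auto
  note int = L2T_integrable[OF H2_L2T[OF x]]
  have "AE z in circle_measure. Re (x z) = 0"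
    by (rule AE_Re_zero_if_moments_zero[OF int moments cnj_moments])
  moreover have "AE z in circle_measure. Re (- \<i> * x z) = 0"
    by (rule AE_Re_zero_if_moments_zero)
      (use int moments cnj_moments in \<open>simp_all add: mult.assoc del: complex_cnj_power\<close>)
  ultimately have "AE z in circle_measure. (cmod (x z))\<^sup>2 = 0"
    by eventually_elim (simp add: complex_eq_iff)
  then have "(\<integral>z. (cmod (x z))\<^sup>2 \<partial>circle_measure) = 0"
    by (rule integral_eq_zero_AE)
  then show False using nonzero by (simp add: l2_norm_def)
qed

section \<open>Boundary functions\<close>

definition has_boundary_function :: "(complex \<Rightarrow> complex) \<Rightarrow> (complex \<Rightarrow> complex) \<Rightarrow> bool" where
  "has_boundary_function g G \<longleftrightarrow> G \<in> borel_measurable borel \<and>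
    (AE z in circle_measure. ((\<lambda>r. g (of_real r * z)) \<longlongrightarrow> G z) (at_left (1::real)))"

lemma has_boundary_function_measurable: "has_boundary_function g G \<Longrightarrow> G \<in> borel_measurable borel"
  by (simp add: has_boundary_function_def)

lemma AE_has_boundary_function:
  "has_boundary_function g G \<Longrightarrow>
    AE z in circle_measure. ((\<lambda>r. g (of_real r * z)) \<longlongrightarrow> G z) (at_left (1::real))"
  by (simp add: has_boundary_function_def)

lemma AE_boundary_value_eq:
  assumes "has_boundary_function g G"
  shows "AE z in circle_measure. boundary_value g z = G z"
  using assms unfolding has_boundary_function_def
  by (auto elim!: eventually_mono simp: boundary_value_def intro!: tendsto_Lim)

lemma Hinfty_iff:
  "g \<in> Hinfty \<longleftrightarrow> g holomorphic_on ball 0 1 \<and> (\<exists>M. \<forall>z. cmod z < 1 \<longrightarrow> cmod (g z) \<le> M)"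
  unfolding Hinfty_def bounded_iff ball_simps by (simp add: Ball_def)

theorem Hinfty_has_boundary_function:
  assumes "g \<in> Hinfty"
  obtains G where "has_boundary_function g G"
proof -
  obtain M where hol: "g holomorphic_on ball 0 1" and M: "\<And>z. cmod z < 1 \<Longrightarrow> cmod (g z) \<le> M"
    using assms unfolding Hinfty_iff by blast
  have coeff: "square_summable (taylor_coeff g)"
    using square_summable_taylor_coeff[OF hol] M by blast
  let ?F = "powser (taylor_coeff g)"
  define G where "G = (\<lambda>z. lim (\<lambda>k. ?F (of_real (radius_seq k) * z)))"
  have [measurable]: "G \<in> borel_measurable borel" unfolding G_def by measurable
  have "AE z in circle_measure. ((\<lambda>r. g (of_real r * z)) \<longlongrightarrow> G z) (at_left (1::real))"
    using AE_powser_radial_limit[OF coeff] AE_circle_norm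
  proof eventually_elim
    case (elim z)
    then obtain l where l: "((\<lambda>r. ?F (of_real r * z)) \<longlongrightarrow> l) (at_left 1)" by blast
    have "G z = l"
      unfolding G_def by (rule limI[OF filterlim_compose[OF l filterlim_radius_seq_at_left]])
    moreover have "\<forall>\<^sub>F r in at_left 1. ?F (of_real r * z) = g (of_real r * z)"
      using eventually_at_left_real[OF zero_less_one]
      by eventually_elim (use elim in \<open>simp add: powser_taylor_coeff hol norm_mult\<close>)
    ultimately show ?case
      using l by (simp add: tendsto_cong)
  qed
  then show ?thesis
    using that[of G] by (simp add: has_boundary_function_def)
qed

lemma has_boundary_function_mult:
  assumes "has_boundary_function f F" "has_boundary_function g G"
  shows "has_boundary_function (\<lambda>w. f w * g w) (\<lambda>z. F z * G z)"
proof -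
  note [measurable] = assms[THEN has_boundary_function_measurable]
  have "AE z in circle_measure. ((\<lambda>r. f (of_real r * z) * g (of_real r * z)) \<longlongrightarrow> F z * G z) (at_left (1::real))"
    using assms[THEN AE_has_boundary_function] by eventually_elim (rule tendsto_mult)
  then show ?thesis
    by (simp add: has_boundary_function_def)
qed

lemma has_boundary_function_inverse_power:
  assumes G: "has_boundary_function g G" and nonzero: "AE z in circle_measure. G z \<noteq> 0"
  shows "has_boundary_function (\<lambda>w. inverse (g w) ^ m) (\<lambda>z. inverse (G z) ^ m)"
proof -
  note [measurable] = has_boundary_function_measurable[OF G]
  have "AE z in circle_measure. ((\<lambda>r. inverse (g (of_real r * z)) ^ m) \<longlongrightarrow> inverse (G z) ^ m) (at_left (1::real))"
    using AE_has_boundary_function[OF G] nonzero by eventually_elim (intro tendsto_intros)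
  then show ?thesis
    by (simp add: has_boundary_function_def)
qed

lemma has_boundary_function_continuous:
  assumes "continuous_on UNIV u"
  shows "has_boundary_function u u"
proof -
  have "((\<lambda>r. u (of_real r * z)) \<longlongrightarrow> u (of_real 1 * z)) (at_left (1::real))" for z
  proof (rule isCont_tendsto_compose[where g = u])
    show "isCont u (of_real 1 * z)"
      using assms by (simp add: continuous_on_eq_continuous_at)
    show "((\<lambda>r. of_real r * z) \<longlongrightarrow> of_real 1 * z) (at_left (1::real))"
      by (intro tendsto_intros)
  qed
  then show ?thesis
    using borel_measurable_continuous_onI[OF assms] by (simp add: has_boundary_function_def)
qed

lemma AE_boundary_function_le:
  assumes G: "has_boundary_function g G" and M: "\<And>z. cmod z < 1 \<Longrightarrow> cmod (g z) \<le> M"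
  shows "AE z in circle_measure. cmod (G z) \<le> M"
  using AE_has_boundary_function[OF G] AE_circle_norm
proof eventually_elim
  case (elim z)
  have "\<forall>\<^sub>F r in at_left 1. cmod (g (of_real r * z)) \<le> M"
    using eventually_at_left_real[OF zero_less_one]
    by eventually_elim (use elim(2) in \<open>simp add: M norm_mult\<close>)
  with tendsto_norm[OF elim(1)] show ?case
    by (rule tendsto_upperbound) simp
qed

lemma integral_powser_mult_power_eq_0:
  assumes c: "square_summable c" and r: "0 \<le> r" "r < 1" and n: "n \<ge> 1"
  shows "(\<integral>z. powser c (of_real r * z) * z ^ n \<partial>circle_measure) = 0"
proof -
  have "(\<integral>z. powser c (of_real r * z) * z ^ n \<partial>circle_measure) = powser c (of_real r * 0) * 0 ^ n"
    by (intro mean_value_circle_measure continuous_intros holomorphic_intros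
        continuous_on_dilation holomorphic_on_dilation holomorphic_on_powser c r) auto
  then show ?thesis using n by simp
qed

lemma boundary_function_in_H2:
  assumes f: "f \<in> Hinfty" and F: "has_boundary_function f F"
  shows "F \<in> H2"
proof -
  let ?M = circle_measure
  obtain M where hol: "f holomorphic_on ball 0 1" and M: "\<And>z. cmod z < 1 \<Longrightarrow> cmod (f z) \<le> M"
    using f unfolding Hinfty_iff by blast
  have [measurable]: "F \<in> borel_measurable borel" using F by (rule has_boundary_function_measurable)
  define f_dil where "f_dil = (\<lambda>k z. powser (taylor_coeff f) (of_real (radius_seq k) * z))"
  have [measurable]: "f_dil k \<in> borel_measurable borel" for k unfolding f_dil_def by measurable
  have f_dil: "f_dil k z = f (of_real (radius_seq k) * z)" if "cmod z = 1" for k z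
    using norm_dilation_less_1[of z "radius_seq k"] radius_seq_bounds[of k] that
    by (simp add: f_dil_def powser_taylor_coeff[OF hol])
  have "(\<integral>z. F z * z ^ n \<partial>?M) = 0" if n: "n \<ge> 1" for n
  proof -
    have "(\<lambda>k. \<integral>z. f_dil k z * z ^ n \<partial>?M) \<longlonglongrightarrow> (\<integral>z. F z * z ^ n \<partial>?M)"
    proof (rule integral_dominated_convergence[where w = "\<lambda>_. M"])
      show "AE z in ?M. (\<lambda>k. f_dil k z * z ^ n) \<longlonglongrightarrow> F z * z ^ n"
        using AE_has_boundary_function[OF F] AE_circle_norm
      proof eventually_elim
        case (elim z)
        have "(\<lambda>k. f_dil k z) \<longlonglongrightarrow> F z"
          unfolding f_dil[OF elim(2)] by (rule filterlim_compose[OF elim(1) filterlim_radius_seq_at_left])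
        then show ?case by (intro tendsto_mult tendsto_const)
      qed
      show "AE z in ?M. norm (f_dil k z * z ^ n) \<le> M" for k
        using norm_dilation_less_1[of _ "radius_seq k"] radius_seq_bounds[of k]
        by (intro AE_circleI) (simp add: f_dil norm_mult norm_power M)
    qed auto
    moreover have "(\<integral>z. f_dil k z * z ^ n \<partial>?M) = 0" for k
      unfolding f_dil_def using n radius_seq_bounds[of k]
      by (intro integral_powser_mult_power_eq_0 square_summable_taylor_coeff[OF hol M]) auto
    ultimately show ?thesis by (simp add: LIMSEQ_const_iff)
  qed
  moreover have "F \<in> L2T"
    by (rule L2T_bounded[OF _ AE_boundary_function_le[OF F M]]) auto
  ultimately show ?thesis by (simp add: H2_iff_moments)
qed

section \<open>Damping multipliers\<close>

lemma integral_excess_less: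
  fixes f :: "'a \<Rightarrow> real"
  assumes f: "integrable M f" "\<And>x. 0 \<le> f x" and e: "0 < e"
  obtains n :: nat where "(\<integral>x. max 0 (f x - real n) \<partial>M) < e"
proof -
  have [measurable]: "f \<in> borel_measurable M" using f(1) by auto
  have "(\<lambda>n. \<integral>x. max 0 (f x - real n) \<partial>M) \<longlonglongrightarrow> (\<integral>x. 0 \<partial>M)"
  proof (rule integral_dominated_convergence[where w = f])
    show "AE x in M. (\<lambda>n. max 0 (f x - real n)) \<longlonglongrightarrow> 0"
    proof (rule AE_I2)
      fix x
      obtain N :: nat where "f x \<le> real N" using real_arch_simple by blast
      then have "\<forall>n\<ge>N. max 0 (f x - real n) = 0" by auto
      then show "(\<lambda>n. max 0 (f x - real n)) \<longlonglongrightarrow> 0"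
        by (intro tendsto_eventually) (auto simp: eventually_sequentially)
    qed
  qed (use f in auto)
  then have "\<forall>\<^sub>F n in sequentially. (\<integral>x. max 0 (f x - real n) \<partial>M) < e"
    using e by (intro order_tendstoD(2)[of _ 0]) auto
  then show ?thesis
    using that by (auto simp: eventually_sequentially)
qed

lemma poly_approx_excess:
  fixes f :: "complex \<Rightarrow> real"
  assumes f: "integrable circle_measure f" "\<And>z. 0 \<le> f z" and e: "0 < e"
  obtains n :: nat where "\<And>d. 0 < d \<Longrightarrow> \<exists>Q. (\<forall>z. cmod z = 1 \<longrightarrow> 0 \<le> Re (poly Q z)) \<and>
    Im (poly Q 0) = 0 \<and> Re (poly Q 0) \<le> e \<and>
    (\<integral>z. \<bar>max 0 (f z - real n) - Re (poly Q z)\<bar> \<partial>circle_measure) \<le> d"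
proof -
  let ?M = circle_measure
  obtain n :: nat where n: "(\<integral>z. max 0 (f z - real n) \<partial>?M) < e / 2"
    using integral_excess_less[OF f, of "e / 2"] e by auto
  define \<kappa> where "\<kappa> = (\<lambda>z. max 0 (f z - real n))"
  have \<kappa>: "integrable ?M \<kappa>" "\<And>z. 0 \<le> \<kappa> z"
    using f(1) by (auto simp: \<kappa>_def)
  have "\<exists>Q. (\<forall>z. cmod z = 1 \<longrightarrow> 0 \<le> Re (poly Q z)) \<and> Im (poly Q 0) = 0 \<and> Re (poly Q 0) \<le> e \<and>
    (\<integral>z. \<bar>\<kappa> z - Re (poly Q z)\<bar> \<partial>?M) \<le> d" if "0 < d" for d
  proof -
    have "0 < min d (e / 2)" using \<open>0 < d\<close> e by simp
    then obtain Q where Q: "\<And>z. cmod z = 1 \<Longrightarrow> 0 \<le> Re (poly Q z)" "Im (poly Q 0) = 0"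
      and close: "(\<integral>z. \<bar>\<kappa> z - Re (poly Q z)\<bar> \<partial>?M) \<le> min d (e / 2)"
      using L1_approx_Re_poly[OF euclidean_finite_borel_measure_circle AE_circle_norm \<kappa>] by metis
    have Q_int: "integrable ?M (\<lambda>z. Re (poly Q z))" using integrable_poly[of Q] by auto
    have "Re (poly Q 0) = (\<integral>z. Re (poly Q z) \<partial>?M)" by (simp add: integral_Re_poly)
    also have "\<dots> \<le> (\<integral>z. \<kappa> z + \<bar>\<kappa> z - Re (poly Q z)\<bar> \<partial>?M)"
      using Q_int \<kappa>(1) by (intro integral_mono) auto
    also have "\<dots> = (\<integral>z. \<kappa> z \<partial>?M) + (\<integral>z. \<bar>\<kappa> z - Re (poly Q z)\<bar> \<partial>?M)"
      using Q_int \<kappa>(1) by (intro Bochner_Integration.integral_add) auto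
    also have "\<dots> \<le> e" using n close by (simp add: \<kappa>_def)
    finally show ?thesis using Q close by auto
  qed
  then show ?thesis
    unfolding \<kappa>_def by (rule that)
qed

lemma quadratic_decay:
  fixes t a :: real
  assumes t: "0 < t" "t \<le> 1" and a: "1 + t \<le> a" and m: "m \<ge> 1"
  shows "t\<^sup>2 * inverse a ^ m \<le> 9 / (real m)\<^sup>2"
proof -
  have "t * t \<le> t * 1" using t by (intro mult_left_mono) auto
  moreover have "(1 + t / 3)\<^sup>2 = 1 + 2 * t / 3 + t * t / 9" by (simp add: power2_eq_square algebra_simps)
  ultimately have square_le: "(1 + t / 3)\<^sup>2 \<le> a" using t a by linarith
  have "real m * t / 3 \<le> 1 + real m * (t / 3)" by simp
  also have "\<dots> \<le> (1 + t / 3) ^ m" using t by (intro Bernoulli_inequality) simp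
  finally have "(real m * t / 3)\<^sup>2 \<le> ((1 + t / 3) ^ m)\<^sup>2"
    using t by (intro power_mono) auto
  also have "\<dots> = ((1 + t / 3)\<^sup>2) ^ m" by (simp add: power_mult[symmetric] mult.commute)
  also have "\<dots> \<le> a ^ m" by (intro power_mono square_le) simp
  finally have "(real m)\<^sup>2 * t\<^sup>2 \<le> 9 * a ^ m"
    by (simp add: power_mult_distrib power_divide)
  moreover have "0 < a ^ m" using t a by simp
  moreover have "0 < (real m)\<^sup>2" using m by simp
  ultimately show ?thesis
    by (simp add: power_inverse field_simps)
qed

lemma exp_minus_le_add_abs_diff:
  fixes p q :: real
  assumes "0 \<le> q"
  shows "exp (- q) \<le> exp (- p) + \<bar>p - q\<bar>"
proof -
  have "exp (- q) * (1 + (q - p)) \<le> exp (- q) * exp (q - p)"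
    by (intro mult_left_mono exp_ge_add_one_self) simp
  also have "\<dots> = exp (- p)" by (simp add: exp_add[symmetric])
  finally have "exp (- q) \<le> exp (- p) + exp (- q) * (p - q)" by (simp add: algebra_simps)
  also have "exp (- q) * (p - q) \<le> exp (- q) * \<bar>p - q\<bar>" by (intro mult_left_mono) auto
  also have "\<dots> \<le> 1 * \<bar>p - q\<bar>" using assms by (intro mult_right_mono) auto
  finally show ?thesis by simp
qed

lemma exp_mult_inverse_power_le:
  fixes t a p q :: real and n m :: nat
  assumes t: "0 < t" "t \<le> 1" and a: "1 + t \<le> a" and m: "m \<ge> 1"
    and p: "- 2 * ln t - real n \<le> p" and q: "0 \<le> q"
  shows "exp (- 2 * q) * inverse a ^ (2 * m) \<le> 81 * exp (2 * real n) / real m ^ 4 + 2 * \<bar>p - q\<bar>"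
proof -
  let ?I = "inverse a ^ (2 * m)"
  have I: "0 \<le> ?I" "?I \<le> 1" using t a by (auto intro!: power_le_one simp: inverse_le_1_iff)
  have "exp (- 2 * p) \<le> exp (2 * real n + 4 * ln t)" using p by simp
  also have "\<dots> = exp (2 * real n) * t ^ 4"
    using t by (simp add: exp_add exp_of_nat_mult[of 4, simplified])
  finally have exp_p: "exp (- 2 * p) \<le> exp (2 * real n) * t ^ 4" .
  have "t ^ 4 * ?I = (t\<^sup>2 * inverse a ^ m)\<^sup>2"
    by (simp add: power_mult_distrib power_mult[symmetric] mult.commute)
  also have "\<dots> \<le> (9 / (real m)\<^sup>2)\<^sup>2"
    using t a by (intro power_mono quadratic_decay m) auto
  finally have decay: "t ^ 4 * ?I \<le> 81 / real m ^ 4"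
    by (simp add: power_divide power_mult[symmetric])
  have "exp (- 2 * q) \<le> exp (- 2 * p) + 2 * \<bar>p - q\<bar>"
    using exp_minus_le_add_abs_diff[of "2 * q" "2 * p"] q by (auto simp: abs_if)
  then have "exp (- 2 * q) * ?I \<le> (exp (- 2 * p) + 2 * \<bar>p - q\<bar>) * ?I"
    by (rule mult_right_mono[OF _ I(1)])
  also have "\<dots> \<le> exp (2 * real n) * t ^ 4 * ?I + 2 * \<bar>p - q\<bar> * 1"
    unfolding distrib_right using I by (intro add_mono mult_right_mono mult_left_mono exp_p) auto
  also have "exp (2 * real n) * t ^ 4 * ?I \<le> exp (2 * real n) * (81 / real m ^ 4)"
    unfolding mult.assoc by (intro mult_left_mono decay) auto
  finally show ?thesis by (simp add: mult.commute)
qed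

lemma l2_norm_exp_minus_poly_minus_1_le:
  assumes Re_nonneg: "\<And>z. cmod z = 1 \<Longrightarrow> 0 \<le> Re (poly Q z)" and Im_0: "Im (poly Q 0) = 0"
  shows "l2_norm (\<lambda>z. exp (- poly Q z) - 1) \<le> sqrt (2 * Re (poly Q 0))"
proof (rule real_le_rsqrt)
  let ?M = circle_measure and ?u = "\<lambda>z. exp (- poly Q z)"
  have cont: "continuous_on S ?u" for S by (intro continuous_intros)
  have [measurable]: "?u \<in> borel_measurable borel"
    by (rule borel_measurable_continuous_onI[OF cont])
  have int: "integrable ?M ?u"
    by (rule integrable_circle_continuous[OF _ cont]) simp
  have pointwise: "(cmod (?u z - 1))\<^sup>2 \<le> 2 - 2 * Re (?u z)" if "cmod z = 1" for z
  proof -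
    have "(cmod (w - 1))\<^sup>2 = (cmod w)\<^sup>2 + 1 - 2 * Re w" for w
      unfolding cmod_power2 by (simp add: power2_eq_square algebra_simps)
    moreover have "(cmod (?u z))\<^sup>2 \<le> 1" using Re_nonneg[OF that] by (simp add: power_le_one)
    ultimately show ?thesis by simp
  qed
  have "(l2_norm (\<lambda>z. ?u z - 1))\<^sup>2 \<le> (\<integral>z. 2 - 2 * Re (?u z) \<partial>?M)"
    unfolding l2_norm_square
  proof (rule integral_mono_AE')
    show "AE z in ?M. (cmod (?u z - 1))\<^sup>2 \<le> 2 - 2 * Re (?u z)"
      by (intro AE_circleI pointwise)
    show "AE z in ?M. 0 \<le> 2 - 2 * Re (?u z)"
      by (intro AE_circleI order_trans[OF zero_le_power2 pointwise])
  qed (use int in auto)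
  also have "\<dots> = 2 - 2 * Re (\<integral>z. ?u z \<partial>?M)"
    using int integral_Re[OF int] by simp
  also have "(\<integral>z. ?u z \<partial>?M) = exp (- poly Q 0)"
    by (rule mean_value_circle_measure) (auto intro!: holomorphic_intros cont)
  also have "Re (exp (- poly Q 0)) = exp (- Re (poly Q 0))"
    using Im_0 by (simp add: Re_exp)
  also have "2 - 2 * exp (- Re (poly Q 0)) \<le> 2 * Re (poly Q 0)"
    using exp_ge_add_one_self[of "- Re (poly Q 0)"] by simp
  finally show "(l2_norm (\<lambda>z. exp (- poly Q z) - 1))\<^sup>2 \<le> 2 * Re (poly Q 0)" .
qed

lemma l2_norm_exp_minus_poly_mult_le:
  assumes [measurable]: "G \<in> borel_measurable borel"
    and G: "AE z in circle_measure. 1 < cmod (G z)"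
    and Re_nonneg: "\<And>z. cmod z = 1 \<Longrightarrow> 0 \<le> Re (poly Q z)"
    and p: "integrable circle_measure p" "\<And>z. - 2 * ln (min 1 (cmod (G z) - 1)) - real n \<le> p z"
    and close: "(\<integral>z. \<bar>p z - Re (poly Q z)\<bar> \<partial>circle_measure) \<le> 1 / real m ^ 4" and m: "m \<ge> 1"
  shows "l2_norm (\<lambda>z. exp (- poly Q z) * inverse (G z) ^ m) \<le> sqrt (81 * exp (2 * real n) + 2) / (real m)\<^sup>2"
proof -
  let ?M = circle_measure
  have integrable: "integrable ?M (\<lambda>z. \<bar>p z - Re (poly Q z)\<bar>)"
    using p(1) integrable_poly[of Q] by simp
  have square: "(cmod (exp (- poly Q z) * inverse (G z) ^ m))\<^sup>2
      = exp (- 2 * Re (poly Q z)) * inverse (cmod (G z)) ^ (2 * m)" for z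
  proof -
    have "(exp (- Re (poly Q z)))\<^sup>2 = exp (- 2 * Re (poly Q z))"
      by (simp add: power2_eq_square exp_add[symmetric])
    then show ?thesis
      by (simp add: norm_mult norm_power norm_inverse power_mult_distrib power_mult[symmetric] mult.commute)
  qed
  have "(l2_norm (\<lambda>z. exp (- poly Q z) * inverse (G z) ^ m))\<^sup>2
      \<le> (\<integral>z. 81 * exp (2 * real n) / real m ^ 4 + 2 * \<bar>p z - Re (poly Q z)\<bar> \<partial>?M)"
    unfolding l2_norm_square square
  proof (rule integral_mono_AE')
    show "AE z in ?M. exp (- 2 * Re (poly Q z)) * inverse (cmod (G z)) ^ (2 * m)
        \<le> 81 * exp (2 * real n) / real m ^ 4 + 2 * \<bar>p z - Re (poly Q z)\<bar>"
      using G AE_circle_norm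
    proof eventually_elim
      case (elim z)
      show ?case
        by (rule exp_mult_inverse_power_le[OF _ _ _ m p(2) Re_nonneg[OF elim(2)]]) (use elim in auto)
    qed
  qed (use integrable in auto)
  also have "\<dots> = 81 * exp (2 * real n) / real m ^ 4 + 2 * (\<integral>z. \<bar>p z - Re (poly Q z)\<bar> \<partial>?M)"
    using integrable by simp
  also have "\<dots> \<le> 81 * exp (2 * real n) / real m ^ 4 + 2 * (1 / real m ^ 4)"
    using close by simp
  also have "\<dots> = (sqrt (81 * exp (2 * real n) + 2) / (real m)\<^sup>2)\<^sup>2"
    by (simp add: power_divide power_mult[symmetric] add_divide_distrib)
  finally show ?thesis by (rule power2_le_imp_le) simp
qed

lemma integrable_ln_min_1:
  fixes f :: "'a \<Rightarrow> real"
  assumes [measurable]: "f \<in> borel_measurable M" and "integrable M (\<lambda>x. ln (f x))"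
  shows "integrable M (\<lambda>x. ln (min 1 (f x)))"
  using assms(2)
proof (rule Bochner_Integration.integrable_bound)
  show "AE x in M. norm (ln (min 1 (f x))) \<le> norm (ln (f x))"
    by (rule AE_I2) (simp add: min_def)
qed measurable

text \<open>
  This replaces the outer function of modulus \<open>min 1 (\<bar>G\<bar> - 1)\<^sup>2\<close>: a multiplier \<open>exp (- Q)\<close> with a
  polynomial \<open>Q\<close> depending on \<open>m\<close> suffices, since only a norm bound on \<open>exp (- Q) / G\<^sup>m\<close> is needed.
\<close>

lemma damping_multipliers:
  assumes [measurable]: "G \<in> borel_measurable borel"
    and G: "AE z in circle_measure. 1 < cmod (G z)"
    and log: "integrable circle_measure (\<lambda>z. ln (cmod (G z) - 1))" and e: "0 < e"
  obtains C where "0 < C" "\<And>m. m \<ge> 1 \<Longrightarrow> \<exists>u. u holomorphic_on UNIV \<and>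
    l2_norm (\<lambda>z. u z - 1) \<le> e \<and> l2_norm (\<lambda>z. u z * inverse (G z) ^ m) \<le> C / (real m)\<^sup>2"
proof -
  define k where "k = (\<lambda>z. 2 * \<bar>ln (min 1 (cmod (G z) - 1))\<bar>)"
  have k: "integrable circle_measure k" "\<And>z. 0 \<le> k z"
    unfolding k_def using integrable_ln_min_1[OF _ log] by simp_all
  have "0 < e\<^sup>2 / 2" using e by simp
  then obtain n :: nat where n: "\<And>d. 0 < d \<Longrightarrow> \<exists>Q. (\<forall>z. cmod z = 1 \<longrightarrow> 0 \<le> Re (poly Q z)) \<and>
      Im (poly Q 0) = 0 \<and> Re (poly Q 0) \<le> e\<^sup>2 / 2 \<and>
      (\<integral>z. \<bar>max 0 (k z - real n) - Re (poly Q z)\<bar> \<partial>circle_measure) \<le> d"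
    using poly_approx_excess[OF k] by blast
  define C where "C = sqrt (81 * exp (2 * real n) + 2)"
  have "\<exists>u. u holomorphic_on UNIV \<and> l2_norm (\<lambda>z. u z - 1) \<le> e \<and>
      l2_norm (\<lambda>z. u z * inverse (G z) ^ m) \<le> C / (real m)\<^sup>2" if m: "m \<ge> 1" for m
  proof -
    obtain Q where Q: "\<And>z. cmod z = 1 \<Longrightarrow> 0 \<le> Re (poly Q z)" "Im (poly Q 0) = 0" "Re (poly Q 0) \<le> e\<^sup>2 / 2"
      and close: "(\<integral>z. \<bar>max 0 (k z - real n) - Re (poly Q z)\<bar> \<partial>circle_measure) \<le> 1 / real m ^ 4"
      using n[of "1 / real m ^ 4"] m by auto
    have "l2_norm (\<lambda>z. exp (- poly Q z) - 1) \<le> sqrt (2 * Re (poly Q 0))"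
      by (rule l2_norm_exp_minus_poly_minus_1_le[OF Q(1,2)])
    also have "\<dots> \<le> sqrt (e\<^sup>2)" using Q(3) by (intro real_sqrt_le_mono) simp
    also have "\<dots> = e" using e by simp
    finally have "l2_norm (\<lambda>z. exp (- poly Q z) - 1) \<le> e" .
    moreover have "l2_norm (\<lambda>z. exp (- poly Q z) * inverse (G z) ^ m) \<le> C / (real m)\<^sup>2"
      unfolding C_def
    proof (rule l2_norm_exp_minus_poly_mult_le[OF _ G Q(1) _ _ close m])
      show "- 2 * ln (min 1 (cmod (G z) - 1)) - real n \<le> max 0 (k z - real n)" for z
        unfolding k_def by linarith
    qed (use k(1) in auto)
    moreover have "(\<lambda>z. exp (- poly Q z)) holomorphic_on UNIV" by (intro holomorphic_intros)
    ultimately show ?thesis by blast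
  qed
  moreover have "0 < C" by (simp add: C_def add_pos_pos)
  ultimately show ?thesis using that by blast
qed

section \<open>Bang's lemma\<close>

definition quadratic_form :: "'i set \<Rightarrow> ('i \<Rightarrow> 'i \<Rightarrow> real) \<Rightarrow> ('i \<Rightarrow> real) \<Rightarrow> real" where
  "quadratic_form I a v = (\<Sum>i\<in>I. \<Sum>j\<in>I. v i * v j * a i j)"

lemma quadratic_form_remove:
  assumes "finite I" "k \<in> I" and sym: "\<And>i j. a i j = a j i"
  shows "quadratic_form I a v =
    quadratic_form (I - {k}) a v + 2 * v k * (\<Sum>j\<in>I - {k}. v j * a j k) + (v k)\<^sup>2 * a k k"
proof -
  have row: "(\<Sum>j\<in>I. v i * v j * a i j) = v i * v k * a i k + (\<Sum>j\<in>I - {k}. v i * v j * a i j)" for i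
    using assms by (intro sum.remove)
  have "(\<Sum>i\<in>I. \<Sum>j\<in>I. v i * v j * a i j)
      = (\<Sum>j\<in>I. v k * v j * a k j) + (\<Sum>i\<in>I - {k}. \<Sum>j\<in>I. v i * v j * a i j)"
    using assms by (intro sum.remove)
  also have "\<dots> = (v k)\<^sup>2 * a k k + (\<Sum>j\<in>I - {k}. v k * v j * a k j)
      + ((\<Sum>i\<in>I - {k}. v i * v k * a i k) + (\<Sum>i\<in>I - {k}. \<Sum>j\<in>I - {k}. v i * v j * a i j))"
    unfolding row sum.distrib by (simp only: power2_eq_square)
  also have "(\<Sum>j\<in>I - {k}. v k * v j * a k j) = v k * (\<Sum>j\<in>I - {k}. v j * a j k)"
    unfolding sum_distrib_left sym[of k] by (simp only: mult.assoc)
  also have "(\<Sum>i\<in>I - {k}. v i * v k * a i k) = v k * (\<Sum>j\<in>I - {k}. v j * a j k)"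
    unfolding sum_distrib_left by (simp only: mult_ac)
  finally show ?thesis by (simp add: quadratic_form_def)
qed

lemma Bang_sign_flip:
  fixes a :: "'i \<Rightarrow> 'i \<Rightarrow> real" and w e :: "'i \<Rightarrow> real"
  assumes I: "finite I" "k \<in> I" and sym: "\<And>i j. a i j = a j i" and diag: "a k k = 1"
    and w: "0 < w k" and sign: "e k = -1 \<or> e k = 1"
    and flip: "quadratic_form I a (\<lambda>i. (e(k := - e k)) i * w i) \<le> quadratic_form I a (\<lambda>i. e i * w i)"
  shows "w k \<le> \<bar>\<Sum>j\<in>I. e j * w j * a j k\<bar>"
proof -
  define r where "r = (\<Sum>j\<in>I - {k}. e j * w j * a j k)"
  have "quadratic_form I a (\<lambda>i. e i * w i)
      = quadratic_form (I - {k}) a (\<lambda>i. e i * w i) + 2 * (e k * w k) * r + (e k * w k)\<^sup>2"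
    unfolding r_def quadratic_form_remove[OF I sym] diag by simp
  moreover have "quadratic_form I a (\<lambda>i. (e(k := - e k)) i * w i)
      = quadratic_form (I - {k}) a (\<lambda>i. e i * w i) - 2 * (e k * w k) * r + (e k * w k)\<^sup>2"
    unfolding r_def quadratic_form_remove[OF I sym] diag
    by (auto simp: quadratic_form_def intro!: sum.cong)
  ultimately have "0 \<le> (e k * r) * w k"
    using flip by (simp add: mult_ac)
  then have "0 \<le> e k * r"
    using w by (simp add: zero_le_mult_iff)
  moreover have "(\<Sum>j\<in>I. e j * w j * a j k) = e k * w k + r"
    unfolding r_def using I by (subst sum.remove[of _ k]) (auto simp: diag)
  ultimately show ?thesis
    using sign w by auto
qed

text \<open>Signs maximising the quadratic form work, because flipping a single sign does not increase it.\<close>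

lemma Bang_finite:
  fixes a :: "'i \<Rightarrow> 'i \<Rightarrow> real" and w :: "'i \<Rightarrow> real"
  assumes I: "finite I" and sym: "\<And>i j. a i j = a j i" and diag: "\<And>k. a k k = 1"
    and w: "\<And>k. 0 < w k"
  obtains e where "\<And>j. \<bar>e j\<bar> \<le> 1" "\<And>k. k \<in> I \<Longrightarrow> w k \<le> \<bar>\<Sum>j\<in>I. e j * w j * a j k\<bar>"
proof -
  define S where "S = I \<rightarrow>\<^sub>E {-1, 1::real}"
  define q where "q = (\<lambda>e. quadratic_form I a (\<lambda>i. e i * w i))"
  have "finite S" "S \<noteq> {}"
    unfolding S_def using I by (auto intro: finite_PiE simp: PiE_eq_empty_iff)
  then obtain e where e: "e \<in> S" and maximal: "\<And>e'. e' \<in> S \<Longrightarrow> q e' \<le> q e"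
    using ex_is_arg_min_if_finite[of S "\<lambda>e. - q e"] by (auto simp: is_arg_min_linorder)
  have sign: "e j = -1 \<or> e j = 1" if "j \<in> I" for j
    using e that unfolding S_def by (auto simp: PiE_iff)
  have "w k \<le> \<bar>\<Sum>j\<in>I. e j * w j * a j k\<bar>" if k: "k \<in> I" for k
  proof (rule Bang_sign_flip[where a = a and w = w and e = e, OF I k sym diag w sign[OF k]])
    have "e(k := - e k) \<in> S"
      using e k sign[OF k] unfolding S_def by (auto simp: PiE_iff extensional_def)
    then have "q (e(k := - e k)) \<le> q e" by (rule maximal)
    then show "quadratic_form I a (\<lambda>i. (e(k := - e k)) i * w i) \<le> quadratic_form I a (\<lambda>i. e i * w i)"
      by (simp only: q_def)
  qed
  moreover have "(\<Sum>j\<in>I. (if j \<in> I then e j else 0) * w j * a j k) = (\<Sum>j\<in>I. e j * w j * a j k)" for k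
    by (intro sum.cong) auto
  moreover have "\<bar>if j \<in> I then e j else 0\<bar> \<le> 1" for j
    using sign[of j] by auto
  ultimately show ?thesis
    by (intro that[of "\<lambda>j. if j \<in> I then e j else 0"]) auto
qed

lemma truncated_sum_tendsto_suminf:
  fixes x :: "nat \<Rightarrow> nat \<Rightarrow> 'a :: {real_normed_algebra, banach}"
  assumes x: "\<And>j. (\<lambda>n. x n j) \<longlonglongrightarrow> y j" and bound: "\<And>n j. norm (x n j) \<le> w j"
    and w: "summable w" and s: "strict_mono s"
  shows "(\<lambda>n. \<Sum>j<s n. x n j) \<longlonglongrightarrow> (\<Sum>j. y j)"
proof -
  define b where "b = (\<lambda>j n. if j < s n then x n j else 0)"
  have lim: "(\<lambda>n. b j n) \<longlonglongrightarrow> y j" for j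
  proof (rule Lim_transform_eventually[OF x])
    have "x n j = b j n" if "Suc j \<le> n" for n
      using seq_suble[OF s, of n] that by (simp add: b_def)
    then show "\<forall>\<^sub>F n in sequentially. x n j = b j n"
      unfolding eventually_sequentially by blast
  qed
  have "norm (b j n) \<le> w j" for j n
    using bound[of n j] order_trans[OF norm_ge_zero bound[of n j]] by (simp add: b_def)
  then have "\<forall>\<^sub>F (j, n) in sequentially \<times>\<^sub>F sequentially. norm (b j n) \<le> w j"
    by (intro always_eventually) auto
  then have "(\<lambda>n. \<Sum>j. b j n) \<longlonglongrightarrow> (\<Sum>j. y j)"
    using tannerys_theorem[OF lim _ w] by simp
  moreover have "(\<Sum>j. b j n) = (\<Sum>j<s n. x n j)" for n
    by (subst suminf_finite[of "{..<s n}"]) (auto simp: b_def)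
  ultimately show ?thesis by simp
qed

lemma Bang_sequence:
  fixes a :: "nat \<Rightarrow> nat \<Rightarrow> real" and w :: "nat \<Rightarrow> real"
  assumes sym: "\<And>j k. a j k = a k j" and diag: "\<And>k. a k k = 1" and bound: "\<And>j k. \<bar>a j k\<bar> \<le> 1"
    and w: "\<And>k. 0 < w k" "summable w"
  obtains e where "\<And>j. \<bar>e j\<bar> \<le> 1" "\<And>k. w k \<le> \<bar>\<Sum>j. e j * w j * a j k\<bar>"
proof -
  have "\<exists>e. (\<forall>j. \<bar>e j\<bar> \<le> 1) \<and> (\<forall>k<n. w k \<le> \<bar>\<Sum>j<n. e j * w j * a j k\<bar>)" for n
    by (rule Bang_finite[of "{..<n}" a w, OF finite_lessThan sym diag w(1)]) (auto simp: lessThan_iff)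
  then have "\<exists>E. \<forall>n. (\<forall>j. \<bar>E n j\<bar> \<le> 1) \<and> (\<forall>k<n. w k \<le> \<bar>\<Sum>j<n. E n j * w j * a j k\<bar>)"
    by (intro choice allI)
  then obtain E where E_le: "\<And>n j. \<bar>E n j\<bar> \<le> 1"
    and E: "\<And>n k. k < n \<Longrightarrow> w k \<le> \<bar>\<Sum>j<n. E n j * w j * a j k\<bar>"
    by blast
  obtain s where s: "strict_mono (s :: nat \<Rightarrow> nat)" and "\<And>j. \<exists>l. (\<lambda>n. E (s n) j) \<longlonglongrightarrow> l"
    using function_convergent_subsequence[of "UNIV :: nat set" E 1] E_le by auto
  then obtain e where e: "\<And>j. (\<lambda>n. E (s n) j) \<longlonglongrightarrow> e j"
    by metis
  have "\<bar>e j\<bar> \<le> 1" for j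
    by (rule LIMSEQ_le_const2[OF tendsto_rabs[OF e[of j]]]) (use E_le in auto)
  moreover have "w k \<le> \<bar>\<Sum>j. e j * w j * a j k\<bar>" for k
  proof (rule LIMSEQ_le_const)
    have "norm (E (s n) j * w j * a j k) \<le> 1 * w j * 1" for n j
      unfolding real_norm_def abs_mult using E_le[of "s n" j] bound[of j k] w(1)[of j] by (intro mult_mono) auto
    then show "(\<lambda>n. \<bar>\<Sum>j<s n. E (s n) j * w j * a j k\<bar>) \<longlonglongrightarrow> \<bar>\<Sum>j. e j * w j * a j k\<bar>"
      by (intro tendsto_rabs truncated_sum_tendsto_suminf[OF _ _ w(2) s] tendsto_mult e tendsto_const) simp
    have "w k \<le> \<bar>\<Sum>j<s n. E (s n) j * w j * a j k\<bar>" if "Suc k \<le> n" for n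
      using seq_suble[OF s, of n] that by (intro E) simp
    then show "\<exists>N. \<forall>n\<ge>N. w k \<le> \<bar>\<Sum>j<s n. E (s n) j * w j * a j k\<bar>"
      by blast
  qed
  ultimately show ?thesis by (rule that)
qed

section \<open>Functionals bounded away from zero along a sequence\<close>

lemma cont_lin_functional_H2I:
  assumes add: "\<And>f h. f \<in> L2T \<Longrightarrow> h \<in> L2T \<Longrightarrow> \<phi> (\<lambda>z. f z + h z) = \<phi> f + \<phi> h"
    and cmult: "\<And>f c. f \<in> L2T \<Longrightarrow> \<phi> (\<lambda>z. c * f z) = c * \<phi> f"
    and bound: "\<And>f. f \<in> L2T \<Longrightarrow> cmod (\<phi> f) \<le> C * l2_norm f" and C: "0 \<le> C"
  shows "cont_lin_functional_H2 \<phi>"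
  unfolding cont_lin_functional_H2_def
proof (intro conjI ballI allI impI)
  fix f and e :: real assume f: "f \<in> H2" and e: "e > 0"
  show "\<exists>d>0. \<forall>h\<in>H2. l2_norm (\<lambda>z. h z - f z) < d \<longrightarrow> cmod (\<phi> h - \<phi> f) < e"
  proof (intro exI[of _ "e / (C + 1)"] conjI ballI impI)
    show "0 < e / (C + 1)" using C e by simp
    fix h assume h: "h \<in> H2" and close: "l2_norm (\<lambda>z. h z - f z) < e / (C + 1)"
    have diff: "(\<lambda>z. h z - f z) \<in> L2T" by (intro L2T_diff H2_L2T f h)
    have "cmod (\<phi> h - \<phi> f) = cmod (\<phi> (\<lambda>z. h z - f z))"
      using add[OF diff H2_L2T[OF f]] by simp
    also have "\<dots> \<le> C * l2_norm (\<lambda>z. h z - f z)" by (rule bound[OF diff])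
    also have "\<dots> \<le> (C + 1) * l2_norm (\<lambda>z. h z - f z)" by (intro mult_right_mono) auto
    also have "\<dots> < e" using close C by (simp add: pos_less_divide_eq mult.commute)
    finally show "cmod (\<phi> h - \<phi> f) < e" .
  qed
qed (auto intro: add cmult H2_L2T)

lemma cont_lin_functional_l2_inner:
  assumes "k \<in> L2T"
  shows "cont_lin_functional_H2 (\<lambda>f. l2_inner f k)"
  by (rule cont_lin_functional_H2I[where C = "l2_norm k"])
    (use assms l2_Cauchy_Schwarz[OF _ assms] in \<open>auto simp: l2_inner_add l2_inner_cmult mult.commute\<close>)

context
  fixes e :: "nat \<Rightarrow> complex \<Rightarrow> complex" and s :: "nat \<Rightarrow> real"
  assumes e: "\<And>j. e j \<in> L2T" "\<And>j. l2_norm (e j) \<le> 1" and s: "summable (\<lambda>j. \<bar>s j\<bar>)"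
begin

lemma norm_l2_series_term_le:
  assumes "f \<in> L2T"
  shows "cmod (of_real (s j) * l2_inner f (e j)) \<le> \<bar>s j\<bar> * l2_norm f"
proof -
  have "cmod (l2_inner f (e j)) \<le> l2_norm f * l2_norm (e j)"
    by (rule l2_Cauchy_Schwarz[OF assms e(1)])
  also have "\<dots> \<le> l2_norm f * 1" by (intro mult_left_mono e) simp
  finally show ?thesis by (simp add: norm_mult mult_left_mono)
qed

lemma summable_l2_series:
  assumes "f \<in> L2T"
  shows "summable (\<lambda>j. of_real (s j) * l2_inner f (e j))"
  by (rule summable_comparison_test'[OF summable_mult2[OF s, of "l2_norm f"], of 0])
    (rule norm_l2_series_term_le[OF assms])

lemma cont_lin_functional_l2_series:
  "cont_lin_functional_H2 (\<lambda>f. \<Sum>j. of_real (s j) * l2_inner f (e j))"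
proof (rule cont_lin_functional_H2I)
  fix f h assume "f \<in> L2T" "h \<in> L2T"
  then show "(\<Sum>j. of_real (s j) * l2_inner (\<lambda>z. f z + h z) (e j))
      = (\<Sum>j. of_real (s j) * l2_inner f (e j)) + (\<Sum>j. of_real (s j) * l2_inner h (e j))"
    by (simp add: suminf_add summable_l2_series l2_inner_add e(1) distrib_left)
next
  fix f c assume "f \<in> L2T"
  then show "(\<Sum>j. of_real (s j) * l2_inner (\<lambda>z. c * f z) (e j)) = c * (\<Sum>j. of_real (s j) * l2_inner f (e j))"
    using suminf_mult[OF summable_l2_series, of f c] by (simp add: l2_inner_cmult mult_ac)
next
  fix f assume "f \<in> L2T"
  then have "cmod (\<Sum>j. of_real (s j) * l2_inner f (e j)) \<le> (\<Sum>j. \<bar>s j\<bar> * l2_norm f)"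
    by (intro norm_suminf_le norm_l2_series_term_le summable_mult2 s)
  also have "\<dots> = (\<Sum>j. \<bar>s j\<bar>) * l2_norm f" by (rule suminf_mult2[OF s, symmetric])
  finally show "cmod (\<Sum>j. of_real (s j) * l2_inner f (e j)) \<le> (\<Sum>j. \<bar>s j\<bar>) * l2_norm f" .
qed (intro suminf_nonneg s, simp)

end

lemma Bang_functional:
  assumes e: "\<And>m. e m \<in> L2T" "\<And>m. l2_norm (e m) = 1" and w: "\<And>m. 0 < w m" "summable w"
  obtains \<phi> where "cont_lin_functional_H2 \<phi>" "\<And>m. w m \<le> cmod (\<phi> (e m))"
proof -
  define a where "a = (\<lambda>j k. Re (l2_inner (e k) (e j)))"
  obtain s where s: "\<And>j. \<bar>s j\<bar> \<le> 1" "\<And>k. w k \<le> \<bar>\<Sum>j. s j * w j * a j k\<bar>"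
  proof (rule Bang_sequence[of a w])
    show "a j k = a k j" for j k
      unfolding a_def using l2_inner_commute[of "e k" "e j"] by simp
    show "a k k = 1" for k
      by (simp add: a_def l2_inner_self e(2))
    show "\<bar>a j k\<bar> \<le> 1" for j k
      using abs_Re_le_cmod[of "l2_inner (e k) (e j)"] l2_Cauchy_Schwarz[OF e(1) e(1), of k j]
      by (simp add: a_def e(2))
  qed (use w in auto)
  have e_le: "l2_norm (e m) \<le> 1" for m by (simp add: e(2))
  have "norm \<bar>s j * w j\<bar> \<le> w j" for j
    using s(1)[of j] w(1)[of j] by (simp add: abs_mult mult_left_le_one_le)
  then have sw: "summable (\<lambda>j. \<bar>s j * w j\<bar>)"
    by (rule summable_comparison_test'[OF w(2), of 0])
  define \<phi> where "\<phi> = (\<lambda>f. \<Sum>j. complex_of_real (s j * w j) * l2_inner f (e j))"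
  have "cont_lin_functional_H2 \<phi>"
    unfolding \<phi>_def by (rule cont_lin_functional_l2_series[OF e(1) e_le sw])
  moreover have "w m \<le> cmod (\<phi> (e m))" for m
  proof -
    have "Re (\<phi> (e m)) = (\<Sum>j. s j * w j * a j m)"
      unfolding \<phi>_def a_def Re_suminf[OF summable_l2_series[OF e(1) e_le sw e(1)]] by simp
    then show ?thesis
      using s(2)[of m] abs_Re_le_cmod[of "\<phi> (e m)"] by simp
  qed
  ultimately show ?thesis by (rule that)
qed

theorem functional_bounded_below_on_sequence:
  assumes y: "\<And>m. y m \<in> H2" and pos: "\<And>m. 0 < l2_norm (y m)"
    and summable: "summable (\<lambda>m. 1 / l2_norm (y m))"
  obtains \<phi> where "cont_lin_functional_H2 \<phi>" "\<And>m. 1 \<le> cmod (\<phi> (y m))"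
proof -
  define w where "w = (\<lambda>m. 1 / l2_norm (y m))"
  define e where "e = (\<lambda>m z. of_real (w m) * y m z)"
  have w: "0 < w m" "summable w" for m using pos summable by (auto simp: w_def)
  have e: "e m \<in> L2T" for m unfolding e_def by (intro L2T_cmult H2_L2T y)
  have norm_e: "l2_norm (e m) = 1" for m
    unfolding e_def l2_norm_cmult using pos[of m] by (simp add: w_def norm_divide)
  obtain \<phi> where \<phi>: "cont_lin_functional_H2 \<phi>" "\<And>m. w m \<le> cmod (\<phi> (e m))"
    using Bang_functional[of e w, OF e norm_e w] by blast
  have "1 \<le> cmod (\<phi> (y m))" for m
  proof -
    have "\<phi> (e m) = of_real (w m) * \<phi> (y m)"
      using \<phi>(1) y[of m] unfolding cont_lin_functional_H2_def e_def by blast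
    then show ?thesis
      using \<phi>(2)[of m] w(1)[of m] by (simp add: norm_mult)
  qed
  with \<phi>(1) show ?thesis by (rule that)
qed

lemma not_one_weakly_hypercyclic_H2I:
  assumes "\<And>x. x \<in> H2 \<Longrightarrow> \<exists>\<phi> w. cont_lin_functional_H2 \<phi> \<and> (\<exists>f\<in>H2. \<phi> f \<noteq> 0) \<and>
    (\<forall>m. 1 \<le> cmod (\<phi> ((A ^^ m) x) - w))"
  shows "\<not> one_weakly_hypercyclic_H2 A"
proof
  assume "one_weakly_hypercyclic_H2 A"
  then obtain x where x: "x \<in> H2"
    and dense: "\<And>\<phi>. cont_lin_functional_H2 \<phi> \<Longrightarrow> \<exists>f\<in>H2. \<phi> f \<noteq> 0 \<Longrightarrow>
      closure (range (\<lambda>m. \<phi> ((A ^^ m) x))) = UNIV"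
    unfolding one_weakly_hypercyclic_H2_def by blast
  obtain \<phi> w where "cont_lin_functional_H2 \<phi>" "\<exists>f\<in>H2. \<phi> f \<noteq> 0"
    and away: "\<And>m. 1 \<le> cmod (\<phi> ((A ^^ m) x) - w)"
    using assms[OF x] by blast
  then have "w \<in> closure (range (\<lambda>m. \<phi> ((A ^^ m) x)))"
    using dense by simp
  then obtain m where "dist (\<phi> ((A ^^ m) x)) w < 1"
    unfolding closure_approachable using zero_less_one by blast
  with away[of m] show False by (simp add: dist_norm)
qed

section \<open>Adjoints of analytic Toeplitz operators\<close>

text \<open>
  The boundary values \<open>b\<close> of \<open>g\<close> need not be Borel off the circle, so that an integral involving them can
  be a junk zero. Testing against functions that vanish where \<open>b\<close> differs from \<open>G\<close> avoids this.
\<close>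

lemma orthogonal_H2_cong_AE:
  assumes orthogonal: "\<And>h. h \<in> H2 \<Longrightarrow> l2_inner F h = 0"
    and eq: "AE z in circle_measure. F z = F' z" and [measurable]: "F' \<in> borel_measurable borel"
    and y: "y \<in> H2"
  shows "l2_inner F' y = 0"
proof -
  note [measurable] = H2_measurable[OF y]
  obtain N where N: "N \<in> null_sets circle_measure" "{z \<in> space circle_measure. F z \<noteq> F' z} \<subseteq> N"
    using eq by (auto simp: eventually_ae_filter)
  have F_eq: "F z = F' z" if "z \<notin> N" for z using N(2) that by auto
  have [measurable]: "N \<in> sets borel" using N(1) by (auto simp: null_sets_def)
  define h where "h = (\<lambda>z. indicator (- N) z * y z)"
  have [measurable]: "h \<in> borel_measurable borel" unfolding h_def by measurable
  have h_eq: "AE z in circle_measure. y z = h z"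
    using AE_not_in[OF N(1)] by eventually_elim (simp add: h_def)
  have "l2_inner F' y = l2_inner F' h"
    by (rule l2_inner_cong_AE) (use h_eq in auto)
  also have "\<dots> = l2_inner F h"
    unfolding l2_inner_def
    by (intro Bochner_Integration.integral_cong) (auto simp: h_def F_eq split: split_indicator)
  also have "\<dots> = 0"
    by (intro orthogonal H2_cong_AE[OF y _ h_eq]) measurable
  finally show ?thesis .
qed

lemma l2_inner_Toeplitz_adjoint:
  assumes Tg_maps: "\<forall>f\<in>H2. Tg f \<in> H2"
    and Tg_proj: "\<forall>f\<in>H2. \<forall>h\<in>H2. l2_inner (\<lambda>z. b z * f z - Tg f z) h = 0"
    and A_adj: "\<forall>f\<in>H2. \<forall>h\<in>H2. l2_inner (Tg f) h = l2_inner f (A h)"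
    and b: "AE z in circle_measure. b z = G z"
    and [measurable]: "G \<in> borel_measurable borel" and G: "AE z in circle_measure. cmod (G z) \<le> M"
    and f: "f \<in> H2" and y: "y \<in> H2"
  shows "l2_inner f (A y) = l2_inner (\<lambda>z. G z * f z) y"
proof -
  have Tg_f: "Tg f \<in> H2" using f Tg_maps by blast
  note [measurable] = H2_measurable[OF f] H2_measurable[OF Tg_f]
  have Gf: "(\<lambda>z. G z * f z) \<in> L2T"
    by (rule L2T_bounded_mult[OF H2_L2T[OF f] _ G]) measurable
  have "AE z in circle_measure. b z * f z - Tg f z = G z * f z - Tg f z"
    using b by eventually_elim simp
  then have "l2_inner (\<lambda>z. G z * f z - Tg f z) y = 0"
    using Tg_proj f by (intro orthogonal_H2_cong_AE[OF _ _ _ y]) auto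
  then show ?thesis
    using A_adj f y by (simp add: l2_inner_diff[OF Gf H2_L2T[OF Tg_f] H2_L2T[OF y]])
qed

locale analytic_Toeplitz_adjoint =
  fixes g G :: "complex \<Rightarrow> complex" and A :: "(complex \<Rightarrow> complex) \<Rightarrow> complex \<Rightarrow> complex"
  assumes g_Hinfty: "g \<in> Hinfty" and g_ge_1: "\<And>z. cmod z < 1 \<Longrightarrow> 1 \<le> cmod (g z)"
    and boundary: "has_boundary_function g G"
    and G_gt_1: "AE z in circle_measure. 1 < cmod (G z)"
    and log_integrable: "integrable circle_measure (\<lambda>z. ln (cmod (G z) - 1))"
    and A_H2: "\<And>y. y \<in> H2 \<Longrightarrow> A y \<in> H2"
    and A_adjoint: "\<And>f y. f \<in> H2 \<Longrightarrow> y \<in> H2 \<Longrightarrow> l2_inner f (A y) = l2_inner (\<lambda>z. G z * f z) y"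
begin

lemma measurable_G [measurable]: "G \<in> borel_measurable borel"
  using boundary by (rule has_boundary_function_measurable)

lemma orbit_H2: "x \<in> H2 \<Longrightarrow> (A ^^ m) x \<in> H2"
  by (induction m) (auto intro: A_H2)

lemma entire_div_power_H2:
  assumes u: "u holomorphic_on UNIV"
  shows "(\<lambda>z. u z * inverse (G z) ^ m) \<in> H2"
proof (rule boundary_function_in_H2)
  have cont: "continuous_on S u" for S
    using holomorphic_on_imp_continuous_on[OF u] by (rule continuous_on_subset) simp
  show "has_boundary_function (\<lambda>w. u w * inverse (g w) ^ m) (\<lambda>z. u z * inverse (G z) ^ m)"
    using G_gt_1
    by (intro has_boundary_function_mult has_boundary_function_continuous cont
        has_boundary_function_inverse_power boundary) (auto elim!: eventually_mono)
  have hol: "(\<lambda>w. u w * inverse (g w) ^ m) holomorphic_on ball 0 1"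
    using g_Hinfty g_ge_1 by (intro holomorphic_intros holomorphic_on_subset[OF u]) (force simp: Hinfty_iff)+
  obtain B where B: "\<forall>v\<in>u ` cball 0 1. cmod v \<le> B"
    using compact_imp_bounded[OF compact_continuous_image[OF cont compact_cball]]
    unfolding bounded_iff by blast
  have "cmod (u w * inverse (g w) ^ m) \<le> B" if "cmod w < 1" for w
  proof -
    have "inverse (cmod (g w)) ^ m \<le> 1"
      using g_ge_1[OF that] by (intro power_le_one) (auto simp: inverse_le_1_iff)
    then have "cmod (u w) * inverse (cmod (g w)) ^ m \<le> cmod (u w)"
      by (intro mult_left_le) auto
    also have "\<dots> \<le> B" using B that by simp
    finally show ?thesis by (simp add: norm_mult norm_power norm_inverse)
  qed
  with hol show "(\<lambda>w. u w * inverse (g w) ^ m) \<in> Hinfty"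
    unfolding Hinfty_iff by blast
qed

lemma l2_inner_orbit:
  assumes u: "u holomorphic_on UNIV" and x: "x \<in> H2"
  shows "l2_inner (\<lambda>z. u z * inverse (G z) ^ m) ((A ^^ m) x) = l2_inner u x"
proof (induction m)
  case (Suc m)
  let ?f = "\<lambda>m z. u z * inverse (G z) ^ m"
  have [measurable]: "u \<in> borel_measurable borel"
    using H2_measurable[OF entire_div_power_H2[OF u, of 0]] by simp
  note [measurable] = H2_measurable[OF orbit_H2[OF x]]
  have "l2_inner (?f (Suc m)) ((A ^^ Suc m) x) = l2_inner (\<lambda>z. G z * ?f (Suc m) z) ((A ^^ m) x)"
    by (simp only: funpow.simps o_apply A_adjoint[OF entire_div_power_H2[OF u] orbit_H2[OF x]])
  also have "\<dots> = l2_inner (?f m) ((A ^^ m) x)"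
  proof (rule l2_inner_cong_AE)
    show "AE z in circle_measure. G z * ?f (Suc m) z = ?f m z"
      using G_gt_1
    proof eventually_elim
      case (elim z)
      then have "G z \<noteq> 0" by auto
      then show ?case by simp
    qed
  qed auto
  finally show ?case by (simp only: Suc.IH)
qed simp

lemma l2_inner_entire_mult_power_close:
  assumes u: "u holomorphic_on UNIV" and x: "x \<in> H2"
  shows "cmod (l2_inner (\<lambda>z. u z * z ^ j) x - l2_inner (\<lambda>z. z ^ j) x) \<le> l2_norm (\<lambda>z. u z - 1) * l2_norm x"
proof -
  have entire_L2: "v \<in> L2T" if "v holomorphic_on UNIV" for v
    using H2_L2T[OF entire_div_power_H2[OF that, of 0]] by simp
  have L2: "(\<lambda>z. u z * z ^ j) \<in> L2T" "(\<lambda>z. z ^ j) \<in> L2T" "(\<lambda>z. u z - 1) \<in> L2T"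
    by (intro entire_L2 holomorphic_intros u)+
  have "cmod (l2_inner (\<lambda>z. u z * z ^ j) x - l2_inner (\<lambda>z. z ^ j) x)
      \<le> l2_norm (\<lambda>z. u z * z ^ j - z ^ j) * l2_norm x"
    unfolding l2_inner_diff[OF L2(1,2) H2_L2T[OF x], symmetric]
    by (intro l2_Cauchy_Schwarz L2T_diff L2 H2_L2T x)
  also have "(\<lambda>z. u z * z ^ j - z ^ j) = (\<lambda>z. (u z - 1) * z ^ j)"
    by (simp add: left_diff_distrib)
  also have "l2_norm (\<lambda>z. (u z - 1) * z ^ j) = l2_norm (\<lambda>z. u z - 1)"
    by (rule l2_norm_mult_power[OF L2T_measurable[OF L2(3)]])
  finally show ?thesis .
qed

lemma orbit_growth:
  assumes x: "x \<in> H2" and nonzero: "l2_norm x \<noteq> 0"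
  obtains c where "0 < c" "\<And>m. m \<ge> 1 \<Longrightarrow> c * (real m)\<^sup>2 \<le> l2_norm ((A ^^ m) x)"
proof -
  obtain j where j: "l2_inner (\<lambda>z. z ^ j) x \<noteq> 0"
    using H2_nonzero_coefficient[OF x nonzero] .
  define b where "b = cmod (l2_inner (\<lambda>z. z ^ j) x)"
  have b: "0 < b" using j by (simp add: b_def)
  have norm_x: "0 < l2_norm x" using nonzero l2_norm_nonneg[of x] by linarith
  obtain C where C: "0 < C" "\<And>m. m \<ge> 1 \<Longrightarrow> \<exists>u. u holomorphic_on UNIV \<and>
      l2_norm (\<lambda>z. u z - 1) \<le> b / (2 * l2_norm x) \<and> l2_norm (\<lambda>z. u z * inverse (G z) ^ m) \<le> C / (real m)\<^sup>2"
    using damping_multipliers[OF measurable_G G_gt_1 log_integrable, of "b / (2 * l2_norm x)"] b norm_x by auto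
  have "b / (2 * C) * (real m)\<^sup>2 \<le> l2_norm ((A ^^ m) x)" if m: "m \<ge> 1" for m
  proof -
    obtain u where u: "u holomorphic_on UNIV" "l2_norm (\<lambda>z. u z - 1) \<le> b / (2 * l2_norm x)"
      "l2_norm (\<lambda>z. u z * inverse (G z) ^ m) \<le> C / (real m)\<^sup>2"
      using C(2)[OF m] by blast
    define v where "v = (\<lambda>z. u z * z ^ j)"
    have v_hol: "v holomorphic_on UNIV" unfolding v_def by (intro holomorphic_intros u)
    have "cmod (l2_inner v x - l2_inner (\<lambda>z. z ^ j) x) \<le> l2_norm (\<lambda>z. u z - 1) * l2_norm x"
      unfolding v_def by (rule l2_inner_entire_mult_power_close[OF u(1) x])
    also have "\<dots> \<le> b / 2"
      using u(2) norm_x by (simp add: field_simps)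
    finally have "b / 2 \<le> cmod (l2_inner v x)"
      using norm_triangle_ineq3[of "l2_inner v x" "l2_inner (\<lambda>z. z ^ j) x"] by (simp add: b_def)
    also have "\<dots> \<le> l2_norm (\<lambda>z. v z * inverse (G z) ^ m) * l2_norm ((A ^^ m) x)"
      unfolding l2_inner_orbit[OF v_hol x, of m, symmetric]
      by (intro l2_Cauchy_Schwarz H2_L2T entire_div_power_H2 v_hol orbit_H2 x)
    also have "(\<lambda>z. v z * inverse (G z) ^ m) = (\<lambda>z. (u z * inverse (G z) ^ m) * z ^ j)"
      by (simp add: v_def mult_ac)
    also have "l2_norm \<dots> = l2_norm (\<lambda>z. u z * inverse (G z) ^ m)"
      by (rule l2_norm_mult_power[OF H2_measurable[OF entire_div_power_H2[OF u(1)]]])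
    also have "\<dots> * l2_norm ((A ^^ m) x) \<le> C / (real m)\<^sup>2 * l2_norm ((A ^^ m) x)"
      using u(3) by (intro mult_right_mono) simp_all
    finally show ?thesis using C(1) m by (simp add: field_simps)
  qed
  then show ?thesis using that[of "b / (2 * C)"] b C(1) by simp
qed

lemma orbit_null:
  assumes x: "x \<in> H2" and null: "l2_norm x = 0"
  shows "l2_norm ((A ^^ m) x) = 0"
proof (induction m)
  case (Suc m)
  obtain M where "\<And>z. cmod z < 1 \<Longrightarrow> cmod (g z) \<le> M"
    using g_Hinfty unfolding Hinfty_iff by blast
  then have "AE z in circle_measure. cmod (G z) \<le> M"
    by (rule AE_boundary_function_le[OF boundary])
  then have GA: "(\<lambda>z. G z * (A ^^ Suc m) x z) \<in> L2T"
    by (intro L2T_bounded_mult[where B = M] H2_L2T orbit_H2 x) auto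
  have "(l2_norm ((A ^^ Suc m) x))\<^sup>2 = cmod (l2_inner ((A ^^ Suc m) x) (A ((A ^^ m) x)))"
    by (simp add: l2_inner_self norm_power)
  also have "\<dots> = cmod (l2_inner (\<lambda>z. G z * (A ^^ Suc m) x z) ((A ^^ m) x))"
    by (simp only: A_adjoint[OF orbit_H2[OF x] orbit_H2[OF x]])
  also have "\<dots> \<le> l2_norm (\<lambda>z. G z * (A ^^ Suc m) x z) * l2_norm ((A ^^ m) x)"
    by (intro l2_Cauchy_Schwarz GA H2_L2T orbit_H2 x)
  finally show ?case by (simp add: Suc.IH)
qed (simp add: null)

lemma summable_inverse_orbit_norm:
  assumes x: "x \<in> H2" "l2_norm x \<noteq> 0"
  shows "summable (\<lambda>m. 1 / l2_norm ((A ^^ m) x))" and "0 < l2_norm ((A ^^ m) x)"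
proof -
  obtain c where c: "0 < c" "\<And>m. m \<ge> 1 \<Longrightarrow> c * (real m)\<^sup>2 \<le> l2_norm ((A ^^ m) x)"
    using orbit_growth[OF x] by blast
  show pos: "0 < l2_norm ((A ^^ m) x)" for m
  proof (cases "m = 0")
    case True
    have "0 < l2_norm x" using x(2) l2_norm_nonneg[of x] by linarith
    then show ?thesis by (simp add: True)
  next
    case False
    then have "0 < c * (real m)\<^sup>2" using c(1) by simp
    also have "\<dots> \<le> l2_norm ((A ^^ m) x)" using c(2) False by simp
    finally show ?thesis .
  qed
  show "summable (\<lambda>m. 1 / l2_norm ((A ^^ m) x))"
  proof (rule summable_comparison_test')
    show "summable (\<lambda>m. 1 / c * inverse (real m ^ 2))"
      by (intro summable_mult inverse_power_summable) simp
    show "norm (1 / l2_norm ((A ^^ m) x)) \<le> 1 / c * inverse (real m ^ 2)" if "m \<ge> 1" for m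
    proof -
      have "1 / l2_norm ((A ^^ m) x) \<le> 1 / (c * (real m)\<^sup>2)"
        using c that by (intro divide_left_mono) (auto intro!: mult_pos_pos pos)
      then show ?thesis by (simp add: field_simps)
    qed
  qed
qed

theorem not_one_weakly_hypercyclic: "\<not> one_weakly_hypercyclic_H2 A"
proof (rule not_one_weakly_hypercyclic_H2I)
  fix x assume x: "x \<in> H2"
  show "\<exists>\<phi> w. cont_lin_functional_H2 \<phi> \<and> (\<exists>f\<in>H2. \<phi> f \<noteq> 0) \<and> (\<forall>m. 1 \<le> cmod (\<phi> ((A ^^ m) x) - w))"
  proof (cases "l2_norm x = 0")
    case True
    let ?\<phi> = "\<lambda>f. l2_inner f (\<lambda>_. 1)"
    have "?\<phi> ((A ^^ m) x) = 0" for m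
      using l2_Cauchy_Schwarz[OF H2_L2T[OF orbit_H2[OF x, of m]] one_in_L2T]
      by (simp add: orbit_null[OF x True])
    moreover have "?\<phi> (\<lambda>_. 1) \<noteq> 0" by (simp add: l2_inner_def)
    ultimately show ?thesis
      using cont_lin_functional_l2_inner[OF one_in_L2T] one_in_H2
      by (intro exI[of _ ?\<phi>] exI[of _ 1] conjI bexI[of _ "\<lambda>_. 1"]) simp_all
  next
    case False
    obtain \<phi> where \<phi>: "cont_lin_functional_H2 \<phi>" "\<And>m. 1 \<le> cmod (\<phi> ((A ^^ m) x))"
      using functional_bounded_below_on_sequence[of "\<lambda>m. (A ^^ m) x", OF orbit_H2[OF x]
        summable_inverse_orbit_norm(2,1)[OF x False]] by blast
    moreover have "\<phi> x \<noteq> 0"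
    proof
      assume "\<phi> x = 0"
      then show False using \<phi>(2)[of 0] by simp
    qed
    ultimately show ?thesis
      using x by (intro exI[of _ \<phi>] exI[of _ 0] conjI bexI[of _ x]) simp_all
  qed
qed

end

theorem theorem1p10:
  fixes g :: "complex \<Rightarrow> complex"
    and Tg A :: "(complex \<Rightarrow> complex) \<Rightarrow> (complex \<Rightarrow> complex)"
  assumes g_Hinf: "g \<in> Hinfty"
    and g_disk: "\<forall>z\<in>ball 0 1. g z \<notin> ball 0 1"
    and g_bd: "AE z in circle_measure. cmod (boundary_value g z) > 1"
    and g_log: "integrable circle_measure (\<lambda>z. ln (cmod (boundary_value g z) - 1))"
    and Tg_maps: "\<forall>f\<in>H2. Tg f \<in> H2"
    and Tg_proj: "\<forall>f\<in>H2. \<forall>h\<in>H2.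
                    l2_inner (\<lambda>z. boundary_value g z * f z - Tg f z) h = 0"
    and A_maps: "\<forall>h\<in>H2. A h \<in> H2"
    and A_adj: "\<forall>f\<in>H2. \<forall>h\<in>H2. l2_inner (Tg f) h = l2_inner f (A h)"
  shows "\<not> one_weakly_hypercyclic_H2 A"
proof -
  obtain G where G: "has_boundary_function g G"
    using Hinfty_has_boundary_function[OF g_Hinf] .
  note [measurable] = has_boundary_function_measurable[OF G]
  note eq = AE_boundary_value_eq[OF G]
  obtain M where M: "\<And>z. cmod z < 1 \<Longrightarrow> cmod (g z) \<le> M"
    using g_Hinf unfolding Hinfty_iff by blast
  interpret analytic_Toeplitz_adjoint g G A
  proof
    show "1 \<le> cmod (g z)" if "cmod z < 1" for z using g_disk that by force
    show "AE z in circle_measure. 1 < cmod (G z)" using g_bd eq by eventually_elim simp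
    show "integrable circle_measure (\<lambda>z. ln (cmod (G z) - 1))"
      by (rule integrable_cong_AE_imp[OF g_log]) (use eq in \<open>auto elim!: eventually_mono\<close>)
    show "l2_inner f (A y) = l2_inner (\<lambda>z. G z * f z) y" if "f \<in> H2" "y \<in> H2" for f y
      using l2_inner_Toeplitz_adjoint[OF Tg_maps Tg_proj A_adj eq _ AE_boundary_function_le[OF G M] that]
      by simp
  qed (use g_Hinf G A_maps in auto)
  show ?thesis by (rule not_one_weakly_hypercyclic)
qed

end
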